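(* Let $X$ be a one-dimensional two-sided 1-step mixing shift of finite type over a finite alphabet $\mathcal{A}$, let $Y$ be a sofic shift over $\mathcal{A}$, and let $\pi:X\to Y$ be a 1-block factor map onto $Y$. If the class degree of $\pi$ satisfies $d_\pi>1$, then there is a fully supported Markov measure $\mu$ on $X$ such that the image measure $\pi\mu$ is not a Gibbs measure on $Y$ (for any continuous potential).
   Context: Notation: $\mathcal{B}(X)$ is the set of words occurring in points of $X$; $X$ is 1-step if $uv,vw\in\mathcal{B}(X)$ with $|v|=1$ implies $uvw\in\mathcal{B}(X)$. $\sigma$ is the shift. For a point $x$ and an interval $I\subset\mathbb{Z}$, $x|_I$ is the restriction of $x$ to $I$. $[w]_i$ denotes the cylinder set of points $x$ with $x|_{[i,i+|w|-1]}=w$. A 1-block map $\pi$ is induced by a map on symbols, also denoted $\pi$. Class degree: Let $y\in Y$ and $x,x'\in\pi^{-1}(y)$. For $m\in\mathbb{Z}$ a right $m$-bridge from $x$ to $x'$ is a point $\vec x\in\pi^{-1}(y)$ such that for some $n>m$, $\vec x|_{(-\infty,m]}=x|_{(-\infty,m]}$ and $\vec x|_{[n,\infty)}=x'|_{[n,\infty)}$. Write $x\to^r x'$ if for every $m\in\mathbb{Z}$ there is a right $m$-bridge from $x$ to $x'$. Write $x\sim^r x'$ if $x\to^r x'$ and $x'\to^r x$; this is an equivalence relation on $\pi^{-1}(y)$ and its classes are the right classes over $y$. Let $d_\pi^r(y)$ be the number of right classes over $y$. The class degree of $\pi$ is $d_\pi=\min_{y\in Y}d_\pi^r(y)$ (it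 is known that the symmetric notion with left classes gives the same number). Measures: All measures are Borel probability measures. A $\sigma$-invariant measure $\mu$ on a shift of finite type over alphabet $\mathcal{A}$ is a 1-step Markov measure if there are a probability vector $p$ on $\mathcal{A}$ and an $\mathcal{A}\times\mathcal{A}$ stochastic matrix $P$ with $\mu[a_1\cdots a_n]_0=p_{a_1}P_{a_1,a_2}\cdots P_{a_{n-1},a_n}$ for all words $a_1\cdots a_n$ of the shift. A Markov measure on $X$ is a measure conjugate (via a topological conjugacy) to a 1-step Markov measure on a shift of finite type. Fully supported means positive on every nonempty cylinder of $X$. A $\sigma$-invariant measure $\nu$ on a shift space $Z$ is a Gibbs measure for a continuous $f:Z\to\mathbb{R}$ if there are $K_1,K_2>0$ and $P\in\mathbb{R}$ with $K_1<\nu[z|_{[0,n-1]}]_0/\exp(-nP+\sum_{j=0}^{n-1}f(\sigma^j z))<K_2$ for all $z\in Z$, $n\in\mathbb{N}$; it is a Gibbs measure if it is so for some continuous $f$. $\pi\mu$ denotes the push-forward $\mu\circ\pi^{-1}$. *)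

theory Defs
  imports "HOL-Probability.Probability_Measure" "HOL-Library.Extended_Nat"
begin

section \<open>Shift spaces\<close>

type_synonym 'a point = "int \<Rightarrow> 'a"

definition shift_map :: "'a point \<Rightarrow> 'a point" where
  "shift_map x = (\<lambda>i. x (i + 1))"

text \<open>\<open>subword x i n\<close> is the word $x_i x_{i+1} \ldots x_{i+n-1}$, i.e. the restriction of \<open>x\<close>
  to the interval $[i, i+n-1]$.\<close>

definition subword :: "'a point \<Rightarrow> int \<Rightarrow> nat \<Rightarrow> 'a list" where
  "subword x i n = map (\<lambda>k. x (i + int k)) [0..<n]"

definition lang :: "'a point set \<Rightarrow> 'a list set" where
  "lang X = {subword x i n | x i n. x \<in> X}"

definition cylinder :: "'a point set \<Rightarrow> 'a list \<Rightarrow> int \<Rightarrow> 'a point set" where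
  "cylinder X w i = {x \<in> X. subword x i (length w) = w}"

text \<open>Taking all of \<open>UNIV\<close> as a discrete space is harmless: on the full shift over a finite alphabet
  the subspace topology is the product of the discrete topologies on the alphabet.\<close>

definition shift_topology :: "'a point set \<Rightarrow> 'a point topology" where
  "shift_topology X = subtopology (product_topology (\<lambda>_. discrete_topology UNIV) UNIV) X"

definition full_shift :: "'a set \<Rightarrow> 'a point set" where
  "full_shift A = {x. range x \<subseteq> A}"

definition shift_space :: "'a set \<Rightarrow> 'a point set \<Rightarrow> bool" where
  "shift_space A X \<longleftrightarrow> finite A \<and> X \<subseteq> full_shift A \<and>
     closedin (shift_topology (full_shift A)) X \<and> shift_map ` X = X"

definition shift_of_finite_type :: "'a set \<Rightarrow> 'a point set \<Rightarrow> bool" where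
  "shift_of_finite_type A X \<longleftrightarrow> finite A \<and>
     (\<exists>F. finite F \<and> X = {x \<in> full_shift A. \<forall>i n. subword x i n \<notin> F})"

definition one_step :: "'a point set \<Rightarrow> bool" where
  "one_step X \<longleftrightarrow>
     (\<forall>u v w. u @ v \<in> lang X \<longrightarrow> v @ w \<in> lang X \<longrightarrow> length v = 1 \<longrightarrow> u @ v @ w \<in> lang X)"

definition mixing :: "'a point set \<Rightarrow> bool" where
  "mixing X \<longleftrightarrow>
     (\<forall>u \<in> lang X. \<forall>w \<in> lang X. \<exists>N. \<forall>n\<ge>N. \<exists>v. length v = n \<and> u @ v @ w \<in> lang X)"

definition factor_map :: "'a point set \<Rightarrow> 'b point set \<Rightarrow> ('a point \<Rightarrow> 'b point) \<Rightarrow> bool" where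
  "factor_map X Y \<pi> \<longleftrightarrow> continuous_map (shift_topology X) (shift_topology Y) \<pi> \<and>
     (\<forall>x\<in>X. \<pi> (shift_map x) = shift_map (\<pi> x)) \<and> \<pi> ` X = Y"

definition conjugacy :: "'a point set \<Rightarrow> 'b point set \<Rightarrow> ('a point \<Rightarrow> 'b point) \<Rightarrow> bool" where
  "conjugacy X Y \<theta> \<longleftrightarrow> homeomorphic_map (shift_topology X) (shift_topology Y) \<theta> \<and>
     (\<forall>x\<in>X. \<theta> (shift_map x) = shift_map (\<theta> x))"

definition one_block_map :: "'a point set \<Rightarrow> ('a point \<Rightarrow> 'b point) \<Rightarrow> bool" where
  "one_block_map X \<pi> \<longleftrightarrow> (\<exists>\<phi>. \<forall>x\<in>X. \<pi> x = (\<lambda>i. \<phi> (x i)))"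

text \<open>A sofic shift is a factor of a shift of finite type. A quantifier over alphabet types is not
  available, but every finite alphabet is in bijection with a finite set of natural numbers.\<close>

definition sofic_shift :: "'a set \<Rightarrow> 'a point set \<Rightarrow> bool" where
  "sofic_shift A Y \<longleftrightarrow> shift_space A Y \<and>
     (\<exists>(B::nat set) Z \<psi>. shift_of_finite_type B Z \<and> factor_map Z Y \<psi>)"


section \<open>Class degree\<close>

definition fiber :: "'a point set \<Rightarrow> ('a point \<Rightarrow> 'b point) \<Rightarrow> 'b point \<Rightarrow> 'a point set" where
  "fiber X \<pi> y = {x \<in> X. \<pi> x = y}"

definition right_bridge ::
  "'a point set \<Rightarrow> ('a point \<Rightarrow> 'b point) \<Rightarrow> 'b point \<Rightarrow> int \<Rightarrow> 'a point \<Rightarrow> 'a point \<Rightarrow> 'a point \<Rightarrow> bool"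
where
  "right_bridge X \<pi> y m x x' z \<longleftrightarrow> z \<in> fiber X \<pi> y \<and>
     (\<exists>n>m. (\<forall>i\<le>m. z i = x i) \<and> (\<forall>i\<ge>n. z i = x' i))"

definition right_arrow ::
  "'a point set \<Rightarrow> ('a point \<Rightarrow> 'b point) \<Rightarrow> 'b point \<Rightarrow> 'a point \<Rightarrow> 'a point \<Rightarrow> bool"
where
  "right_arrow X \<pi> y x x' \<longleftrightarrow> (\<forall>m. \<exists>z. right_bridge X \<pi> y m x x' z)"

definition right_equiv ::
  "'a point set \<Rightarrow> ('a point \<Rightarrow> 'b point) \<Rightarrow> 'b point \<Rightarrow> ('a point \<times> 'a point) set"
where
  "right_equiv X \<pi> y = {(x, x'). x \<in> fiber X \<pi> y \<and> x' \<in> fiber X \<pi> y \<and>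
     right_arrow X \<pi> y x x' \<and> right_arrow X \<pi> y x' x}"

definition right_classes ::
  "'a point set \<Rightarrow> ('a point \<Rightarrow> 'b point) \<Rightarrow> 'b point \<Rightarrow> 'a point set set"
where
  "right_classes X \<pi> y = fiber X \<pi> y // right_equiv X \<pi> y"

text \<open>The number of right classes over a point is a priori possibly infinite, hence \<open>enat\<close>; the
  constant \<open>card\<close> alone would count an infinite set as \<open>0\<close>.\<close>

definition num_right_classes ::
  "'a point set \<Rightarrow> ('a point \<Rightarrow> 'b point) \<Rightarrow> 'b point \<Rightarrow> enat"
where
  "num_right_classes X \<pi> y =
     (if finite (right_classes X \<pi> y) then enat (card (right_classes X \<pi> y)) else \<infinity>)"

text \<open>The infimum is attained for nonempty \<open>Y\<close>; for empty \<open>Y\<close> it has the junk value \<open>\<infinity>\<close>.\<close>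

definition class_degree :: "'a point set \<Rightarrow> 'b point set \<Rightarrow> ('a point \<Rightarrow> 'b point) \<Rightarrow> enat" where
  "class_degree X Y \<pi> = (INF y\<in>Y. num_right_classes X \<pi> y)"


section \<open>Measures\<close>

definition borel_shift :: "'a point set \<Rightarrow> 'a point measure" where
  "borel_shift X = sigma X {U. openin (shift_topology X) U}"

definition invariant_measure :: "'a point set \<Rightarrow> 'a point measure \<Rightarrow> bool" where
  "invariant_measure X \<mu> \<longleftrightarrow> prob_space \<mu> \<and> space \<mu> = X \<and> sets \<mu> = sets (borel_shift X) \<and>
     (\<forall>E\<in>sets \<mu>. emeasure \<mu> (shift_map -` E \<inter> X) = emeasure \<mu> E)"

definition push_forward ::
  "'a point measure \<Rightarrow> 'b point set \<Rightarrow> ('a point \<Rightarrow> 'b point) \<Rightarrow> 'b point measure"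
where
  "push_forward \<mu> Y \<pi> = distr \<mu> (borel_shift Y) \<pi>"

definition probability_vector :: "'a set \<Rightarrow> ('a \<Rightarrow> real) \<Rightarrow> bool" where
  "probability_vector A p \<longleftrightarrow> (\<forall>a\<in>A. 0 \<le> p a) \<and> (\<Sum>a\<in>A. p a) = 1"

definition stochastic_matrix :: "'a set \<Rightarrow> ('a \<Rightarrow> 'a \<Rightarrow> real) \<Rightarrow> bool" where
  "stochastic_matrix A P \<longleftrightarrow> (\<forall>a\<in>A. probability_vector A (P a))"

definition one_step_markov_measure :: "'a set \<Rightarrow> 'a point set \<Rightarrow> 'a point measure \<Rightarrow> bool" where
  "one_step_markov_measure A X \<mu> \<longleftrightarrow> shift_of_finite_type A X \<and> invariant_measure X \<mu> \<and>
     (\<exists>p P. probability_vector A p \<and> stochastic_matrix A P \<and>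
        (\<forall>w\<in>lang X. w \<noteq> [] \<longrightarrow>
           measure \<mu> (cylinder X w 0) = p (hd w) * (\<Prod>i<length w - 1. P (w ! i) (w ! Suc i))))"

text \<open>As for sofic shifts, natural-number alphabets represent all finite alphabets.\<close>

definition markov_measure :: "'a point set \<Rightarrow> 'a point measure \<Rightarrow> bool" where
  "markov_measure X \<mu> \<longleftrightarrow>
     (\<exists>(B::nat set) Z \<nu> \<theta>. one_step_markov_measure B Z \<nu> \<and> conjugacy Z X \<theta> \<and>
        \<mu> = push_forward \<nu> X \<theta>)"

definition fully_supported :: "'a point set \<Rightarrow> 'a point measure \<Rightarrow> bool" where
  "fully_supported X \<mu> \<longleftrightarrow> (\<forall>w i. cylinder X w i \<noteq> {} \<longrightarrow> measure \<mu> (cylinder X w i) > 0)"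

definition gibbs_measure_for :: "'a point set \<Rightarrow> 'a point measure \<Rightarrow> ('a point \<Rightarrow> real) \<Rightarrow> bool" where
  "gibbs_measure_for Z \<nu> f \<longleftrightarrow> invariant_measure Z \<nu> \<and>
     continuous_map (shift_topology Z) euclideanreal f \<and>
     (\<exists>K1 K2 P::real. K1 > 0 \<and> K2 > 0 \<and>
        (\<forall>z\<in>Z. \<forall>n\<ge>1.
           K1 < measure \<nu> (cylinder Z (subword z 0 n) 0) /
                  exp (- real n * P + (\<Sum>j<n. f ((shift_map ^^ j) z))) \<and>
           measure \<nu> (cylinder Z (subword z 0 n) 0) /
                  exp (- real n * P + (\<Sum>j<n. f ((shift_map ^^ j) z))) < K2))"

definition gibbs_measure :: "'a point set \<Rightarrow> 'a point measure \<Rightarrow> bool" where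
  "gibbs_measure Z \<nu> \<longleftrightarrow> (\<exists>f. gibbs_measure_for Z \<nu> f)"

end

theory Submission
  imports Defs "HOL-Computational_Algebra.Primes" "HOL-Probability.Infinite_Product_Measure"
begin

text \<open>A Gibbs measure \<open>\<nu>\<close> is quasi-Bernoulli: \<open>\<nu>[v w] \<ge> K \<nu>[v] \<nu>[w]\<close> for all words \<open>v w\<close> of \<open>Y\<close>.
  Let \<open>u\<close> be the image of a loop at a symbol \<open>a\<close> of \<open>X\<close>. If for every admissible \<open>v\<close> some word
  \<open>u\<^sup>i v u\<^sup>j\<close> had a lift from \<open>a\<close> to \<open>a\<close>, then a synchronization argument would give a word all of
  whose lifts can be rerouted through \<open>a\<close>, and the class degree would be \<open>1\<close>. So some \<open>v\<close> admits no
  such lift although all \<open>u\<^sup>m v u\<^sup>m\<close> occur in \<open>Y\<close>. Choose the loop of prime length with a nonconstant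
  image, so that \<open>u\<close> occurs in its powers only at the obvious places, and take a Markov measure with
  long memory under which the chain almost deterministically runs to the loop and stays there. Lifts
  of \<open>u\<^sup>m\<close> that avoid the loop are then exponentially rarer than the loop itself; but every lift of
  \<open>u\<^sup>m v u\<^sup>m\<close> avoids the loop in one of the two blocks, which contradicts the quasi-Bernoulli
  property for large \<open>m\<close>.\<close>

section \<open>Edge shifts and labelled paths\<close>

text \<open>The lifts of a word define a relation between start and end symbols, and concatenation
  of words becomes composition. Synchronization is thus a question about finitely many relations:
  some power of the relation of \<open>u\<close> is idempotent, and padding by it makes the family
  of nonempty relations closed under nonempty products.

  Long memory is forced: the loop may pass through one symbol several times with different
  successors, so a chain on the symbols of \<open>X\<close> need not be able to follow it almost
  deterministically. On blocks of the length of the loop it becomes a simple cycle, because two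
  equal blocks would give its labels a smaller period. A prime length excludes this once the labels
  are not all equal; a single label on all of \<open>X\<close> would give class degree
  \<open>1\<close> by mixing.

  The rare steps must beat the number of lifts: a stretch of \<open>D + 1\<close> copies of
  \<open>u\<close> that avoids the loop costs a factor \<eta>, while the number of candidate lifts
  grows by a fixed factor per stretch. For \<eta> at most a quarter of the inverse of that factor,
  after \<open>q\<close> stretches the avoiding lifts weigh at most \<open>4^-q\<close>, and the
  loop at least a constant times \<open>2^-q\<close>.\<close>

lemma length_subword [simp]: "length (subword x i n) = n"
  by (simp add: subword_def)

lemma nth_subword [simp]: "k < n \<Longrightarrow> subword x i n ! k = x (i + int k)"
  by (simp add: subword_def)

lemma subword_eq_iff: "subword x i (length w) = w \<longleftrightarrow> (\<forall>k<length w. x (i + int k) = w ! k)"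
  by (auto simp: list_eq_iff_nth_eq)

lemma subword_append: "subword x i (m + n) = subword x i m @ subword x (i + int m) n"
  by (rule nth_equalityI) (auto simp: nth_append add.assoc of_nat_diff)

lemma lang_appendD:
  assumes "u @ v \<in> lang X"
  shows "u \<in> lang X" "v \<in> lang X"
proof -
  obtain x i n where x: "x \<in> X" "u @ v = subword x i n"
    using assms by (auto simp: lang_def)
  then have n: "n = length u + length v"
    by (metis length_append length_subword)
  have "u = subword x i (length u)" "v = subword x (i + int (length u)) (length v)"
    using x(2) unfolding n subword_append by (auto simp: append_eq_append_conv)
  then show "u \<in> lang X" "v \<in> lang X"
    using x(1) by (auto simp: lang_def)
qed

definition edge_shift :: "('a \<times> 'a) set \<Rightarrow> 'a point set" where
  "edge_shift E = {x. \<forall>i. (x i, x (i + 1)) \<in> E}"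

lemma edge_shift_step:
  assumes "x \<in> edge_shift E"
  shows "(x (i + int k), x (i + int (Suc k))) \<in> E"
proof -
  have "(x (i + int k), x ((i + int k) + 1)) \<in> E"
    using assms by (simp add: edge_shift_def)
  moreover have "(i + int k) + 1 = i + int (Suc k)"
    by simp
  ultimately show ?thesis
    by metis
qed

definition transitions :: "'a point set \<Rightarrow> ('a \<times> 'a) set" where
  "transitions X = {(s, t). [s, t] \<in> lang X}"

lemma point_transitions: "x \<in> X \<Longrightarrow> (x i, x (i + 1)) \<in> transitions X"
proof -
  assume "x \<in> X"
  moreover have "[x i, x (i + 1)] = subword x i 2"
    by (simp add: subword_def upt_rec numeral_2_eq_2)
  ultimately show ?thesis
    by (auto simp: transitions_def lang_def)
qed

lemma path_in_lang:
  assumes X: "one_step X" and n: "n > 0"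
    and p: "\<And>i. i < n \<Longrightarrow> (p i, p (Suc i)) \<in> transitions X"
  shows "map p [0..<Suc n] \<in> lang X"
  using n p
proof (induction n)
  case (Suc n)
  show ?case
  proof (cases "n = 0")
    case True
    then show ?thesis
      using Suc.prems by (auto simp: transitions_def)
  next
    case False
    have "map p [0..<n] @ [p n] \<in> lang X"
      using Suc.IH Suc.prems False by simp
    moreover have "[p n] @ [p (Suc n)] \<in> lang X"
      using Suc.prems by (auto simp: transitions_def)
    ultimately have "map p [0..<n] @ [p n] @ [p (Suc n)] \<in> lang X"
      using X unfolding one_step_def by (metis One_nat_def length_Cons list.size(3))
    then show ?thesis
      by simp
  qed
qed simp

text \<open>The one-step property puts every word along allowed transitions into
  \<open>lang X\<close>, and a word of \<open>lang X\<close> is never forbidden; so a point of the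
  edge shift meets all conditions that define \<open>X\<close>.\<close>

lemma one_step_eq_edge_shift:
  assumes sft: "shift_of_finite_type A X" and X: "one_step X"
  shows "X = edge_shift (transitions X)"
proof
  show "X \<subseteq> edge_shift (transitions X)"
    by (auto simp: edge_shift_def point_transitions)
next
  obtain F where F: "X = {x \<in> full_shift A. \<forall>i n. subword x i n \<notin> F}"
    using sft by (auto simp: shift_of_finite_type_def)
  show "edge_shift (transitions X) \<subseteq> X"
  proof
    fix x assume x: "x \<in> edge_shift (transitions X)"
    have sub: "subword x i n \<in> lang X" for i n
    proof -
      \<comment> \<open>Two spare letters guarantee at least one edge, so that the empty word and
        single letters are covered too.\<close>
      have "map (\<lambda>k. x (i + int k)) [0..<Suc (Suc n)] \<in> lang X"
        using edge_shift_step[OF x] by (intro path_in_lang[OF X]) auto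
      then have "subword x i (n + 2) \<in> lang X"
        by (simp add: subword_def)
      then show ?thesis
        unfolding subword_append by (rule lang_appendD)
    qed
    have occ: "\<exists>z\<in>X. \<exists>j. subword x i n = subword z j n" for i n
    proof -
      obtain z j m where z: "z \<in> X" "subword x i n = subword z j m"
        using sub[of i n] by (auto simp: lang_def)
      then have "m = n"
        by (metis length_subword)
      with z show ?thesis
        by blast
    qed
    have "x i \<in> A" for i
    proof -
      obtain z j where "z \<in> X" "subword x i 1 = subword z j 1"
        using occ by blast
      then show ?thesis
        by (auto simp: subword_def F full_shift_def)
    qed
    moreover have "subword x i n \<notin> F" for i n
      using occ[of i n] by (auto simp: F)
    ultimately show "x \<in> X"
      by (auto simp: F full_shift_def)
  qed
qed

text \<open>A letter labels the starting symbol of an edge, so the final symbol of a path carries no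
  condition. Consecutive words then share no letter, and concatenation is composition of
  relations.\<close>

fun label_rel :: "('a \<times> 'a) set \<Rightarrow> ('a \<Rightarrow> 'b) \<Rightarrow> 'b list \<Rightarrow> ('a \<times> 'a) set" where
  "label_rel E \<phi> [] = Id"
| "label_rel E \<phi> (c # w) = {(s, t) \<in> E. \<phi> s = c} O label_rel E \<phi> w"

lemma label_rel_append: "label_rel E \<phi> (v @ w) = label_rel E \<phi> v O label_rel E \<phi> w"
  by (induction v) (auto simp: O_assoc)

lemma label_rel_iff_path:
  "(s, t) \<in> label_rel E \<phi> w \<longleftrightarrow>
     (\<exists>p. p 0 = s \<and> p (length w) = t \<and> (\<forall>i<length w. (p i, p (Suc i)) \<in> E \<and> \<phi> (p i) = w ! i))"
proof (induction w arbitrary: s)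
  case Nil
  show ?case by auto
next
  case (Cons c w)
  show ?case
  proof
    assume "(s, t) \<in> label_rel E \<phi> (c # w)"
    then obtain r where r: "(s, r) \<in> E" "\<phi> s = c" "(r, t) \<in> label_rel E \<phi> w"
      by auto
    then obtain p where "p 0 = r" "p (length w) = t"
        "\<forall>i<length w. (p i, p (Suc i)) \<in> E \<and> \<phi> (p i) = w ! i"
      using Cons.IH by blast
    with r show "\<exists>p. p 0 = s \<and> p (length (c # w)) = t \<and>
        (\<forall>i<length (c # w). (p i, p (Suc i)) \<in> E \<and> \<phi> (p i) = (c # w) ! i)"
      by (intro exI[of _ "\<lambda>i. case i of 0 \<Rightarrow> s | Suc j \<Rightarrow> p j"]) (auto split: nat.split)
  next
    assume "\<exists>p. p 0 = s \<and> p (length (c # w)) = t \<and>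
        (\<forall>i<length (c # w). (p i, p (Suc i)) \<in> E \<and> \<phi> (p i) = (c # w) ! i)"
    then obtain p where p: "p 0 = s" "p (length (c # w)) = t"
        "\<And>i. i < length (c # w) \<Longrightarrow> (p i, p (Suc i)) \<in> E \<and> \<phi> (p i) = (c # w) ! i"
      by blast
    have "(p (Suc 0), t) \<in> label_rel E \<phi> w"
      unfolding Cons.IH using p(2) p(3)[of "Suc _"]
      by (intro exI[of _ "\<lambda>i. p (Suc i)"]) auto
    then show "(s, t) \<in> label_rel E \<phi> (c # w)"
      using p(1) p(3)[of 0] by auto
  qed
qed

lemma relpow_label_rel: "label_rel E \<phi> (concat (replicate k u)) = label_rel E \<phi> u ^^ k"
proof (induction k)
  case (Suc k)
  then show ?case
    by (simp only: replicate_Suc concat.simps label_rel_append relpow_commute relpow.simps)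
qed simp

lemma label_rel_subset: "w \<noteq> [] \<Longrightarrow> label_rel E \<phi> w \<subseteq> Field E \<times> Field E"
proof (induction w)
  case (Cons c w)
  then show ?case
    by (cases w) (auto simp: Field_def)
qed simp

lemma path_label_rel:
  assumes "\<And>i. i < n \<Longrightarrow> (p i, p (Suc i)) \<in> E"
  shows "(p 0, p n) \<in> label_rel E \<phi> (map (\<lambda>i. \<phi> (p i)) [0..<n])"
  unfolding label_rel_iff_path using assms by (intro exI[of _ p]) auto

lemma subword_label_rel:
  assumes "x \<in> edge_shift E"
  shows "(x i, x (i + int n)) \<in> label_rel E \<phi> (subword (\<lambda>i. \<phi> (x i)) i n)"
  using path_label_rel[of n "\<lambda>k. x (i + int k)" E \<phi>] edge_shift_step[OF assms]
  by (simp add: subword_def)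

text \<open>There are finitely many relations on \<open>S\<close>, so the positive powers of
  \<open>R\<close> are eventually periodic. The condition \<open>k > 0\<close> rules out the
  identity as a trivial idempotent.\<close>

lemma finite_relation_idempotent_power:
  fixes R :: "('a \<times> 'a) set"
  assumes "finite S" "R \<subseteq> S \<times> S"
  obtains k where "k > 0" "R ^^ k O R ^^ k = R ^^ k"
proof -
  have "R ^^ k \<subseteq> S \<times> S" if "k > 0" for k
    using that assms(2) by (induction k) (fastforce simp: gr0_conv_Suc)+
  then have "range (\<lambda>k. R ^^ Suc k) \<subseteq> Pow (S \<times> S)"
    by blast
  then have "finite (range (\<lambda>k. R ^^ Suc k))"
    using assms(1) by (meson finite_Pow_iff finite_SigmaI finite_subset)
  then have "\<not> inj (\<lambda>k. R ^^ Suc k)"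
    using finite_imageD infinite_UNIV_nat by blast
  then obtain i j where ij: "i < j" "R ^^ Suc i = R ^^ Suc j"
    by (auto simp: inj_def) (metis linorder_neqE_nat)
  define d where "d = j - i"
  have step: "R ^^ (m + d) = R ^^ m" if "m \<ge> Suc i" for m
  proof -
    have "m + d = Suc j + (m - Suc i)"
      using that ij(1) by (simp add: d_def)
    then have "R ^^ (m + d) = R ^^ (Suc j + (m - Suc i))"
      by (rule arg_cong)
    also have "\<dots> = R ^^ Suc i O R ^^ (m - Suc i)"
      by (simp only: relpow_add ij(2))
    also have "\<dots> = R ^^ (Suc i + (m - Suc i))"
      by (simp only: relpow_add)
    also have "Suc i + (m - Suc i) = m"
      using that by simp
    finally show ?thesis .
  qed
  have steps: "R ^^ (m + l * d) = R ^^ m" if "m \<ge> Suc i" for m l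
    using that
  proof (induction l)
    case (Suc l)
    have "R ^^ (m + Suc l * d) = R ^^ ((m + l * d) + d)"
      by (simp add: algebra_simps)
    then show ?case
      using step[of "m + l * d"] Suc by simp
  qed simp
  have d: "d > 0"
    using ij by (simp add: d_def)
  \<comment> \<open>A multiple of the period \<open>d\<close> beyond the preperiod
    \<open>Suc i\<close>, so adding \<open>k\<close> to the exponent \<open>k\<close> changes
    nothing.\<close>
  define k where "k = Suc i * d"
  have "k \<ge> Suc i"
    using mult_le_mono2[of 1 d "Suc i"] d by (simp add: k_def)
  then have "R ^^ (k + k) = R ^^ k"
    using steps[of k "Suc i"] by (simp add: k_def)
  then show thesis
    using that[of k] d by (simp add: relpow_add k_def)
qed

section \<open>Class degree and synchronization\<close>

lemma edge_shift_translate: "x \<in> edge_shift E \<Longrightarrow> (\<lambda>j. x (j + c)) \<in> edge_shift E"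
  by (auto simp: edge_shift_def) (metis add.assoc add.commute)

text \<open>Serves to build bridges inside a fibre: a path over \<open>w\<close> leads from one
  point to the other and prescribes the labels in between.\<close>

lemma edge_shift_glue:
  assumes x: "x \<in> edge_shift E" and x': "x' \<in> edge_shift E"
    and st: "(x i, x' (i + int (length w))) \<in> label_rel E \<phi> w"
  obtains z where "z \<in> edge_shift E" "\<And>j. j \<le> i \<Longrightarrow> z j = x j"
    "\<And>j. j \<ge> i + int (length w) \<Longrightarrow> z j = x' j"
    "\<And>k. k < length w \<Longrightarrow> \<phi> (z (i + int k)) = w ! k"
proof -
  define l where "l = length w"
  obtain q where q: "q 0 = x i" "q l = x' (i + int l)"
      "\<And>k. k < l \<Longrightarrow> (q k, q (Suc k)) \<in> E \<and> \<phi> (q k) = w ! k"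
    using st unfolding label_rel_iff_path l_def by blast
  define z where "z = (\<lambda>j. if j \<le> i then x j else if j \<ge> i + int l then x' j else q (nat (j - i)))"
  have zq: "z (i + int k) = q k" if "k \<le> l" for k
    using that q(1,2) by (cases "k = l") (auto simp: z_def)
  have zx': "z j = x' j" if "j \<ge> i + int l" for j
    using that q zq[of l] by (cases "j = i + int l") (auto simp: z_def)
  have "(z j, z (j + 1)) \<in> E" for j
  proof -
    consider "j < i" | "i \<le> j" "j < i + int l" | "j \<ge> i + int l"
      by linarith
    then show ?thesis
    proof cases
      case 1
      then show ?thesis
        using x by (auto simp: z_def edge_shift_def)
    next
      case 2
      then obtain k where k: "j = i + int k" "k < l"
        by (metis add_less_cancel_left le_iff_diff_le_0 nonneg_int_cases add.commute
            diff_add_cancel diff_ge_0_iff_ge of_nat_less_iff)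
      then have "z j = q k" "z (j + 1) = q (Suc k)"
        using zq[of k] zq[of "Suc k"] by (auto simp: add.assoc add.commute[of 1])
      then show ?thesis
        using q(3) k by simp
    next
      case 3
      then have "z j = x' j" "z (j + 1) = x' (j + 1)"
        by (simp_all add: zx')
      then show ?thesis
        using x' by (auto simp: edge_shift_def)
    qed
  qed
  then have "z \<in> edge_shift E"
    by (auto simp: edge_shift_def)
  then show thesis
    using that[of z] zq zx' q(3) unfolding l_def by (auto simp: z_def)
qed

lemma periodic_point:
  assumes l: "l > 0" and p: "\<And>i. i < l \<Longrightarrow> (p i, p (Suc i)) \<in> E" and "p l = p 0"
  shows "(\<lambda>i. p (nat (i mod int l))) \<in> edge_shift E"
proof -
  have "(p (nat (i mod int l)), p (nat ((i + 1) mod int l))) \<in> E" for i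
  proof -
    define r where "r = nat (i mod int l)"
    have r: "r < l" "int r = i mod int l"
      using l by (auto simp: r_def nat_less_iff)
    have "(i + 1) mod int l = (int r + 1) mod int l"
      by (simp only: r mod_add_left_eq)
    also have "\<dots> = int (Suc r mod l)"
      by (simp add: zmod_int add.commute)
    finally have "nat ((i + 1) mod int l) = Suc r mod l"
      by simp
    moreover have "p (Suc r mod l) = p (Suc r)"
      using r \<open>p l = p 0\<close> by (cases "Suc r = l") auto
    ultimately show ?thesis
      using p[OF r(1)] by (simp add: r_def)
  qed
  then show ?thesis
    by (auto simp: edge_shift_def)
qed

text \<open>Any two points over the periodic point \<open>(v w)\<^sup>\<infinity>\<close> can be joined through \<open>a\<close>.\<close>

lemma class_degree_le_1:
  assumes X: "X = edge_shift E" and Y: "Y = \<pi> ` X" and \<pi>: "\<And>x. x \<in> X \<Longrightarrow> \<pi> x = (\<lambda>i. \<phi> (x i))"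
    and aa: "(a, a) \<in> label_rel E \<phi> v" "(a, a) \<in> label_rel E \<phi> w" and ne: "v \<noteq> []"
    and thru: "\<And>s t. (s, t) \<in> label_rel E \<phi> (v @ w) \<Longrightarrow>
      (s, a) \<in> label_rel E \<phi> v \<and> (a, t) \<in> label_rel E \<phi> w"
  shows "class_degree X Y \<pi> \<le> 1"
proof -
  define l where "l = length (v @ w)"
  have l: "l > 0"
    using ne by (simp add: l_def)
  have "(a, a) \<in> label_rel E \<phi> (v @ w)"
    using aa by (auto simp: label_rel_append)
  then obtain p where p: "p 0 = a" "p l = a"
      "\<And>i. i < l \<Longrightarrow> (p i, p (Suc i)) \<in> E \<and> \<phi> (p i) = (v @ w) ! i"
    unfolding label_rel_iff_path l_def by blast
  define x0 where "x0 = (\<lambda>i. p (nat (i mod int l)))"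
  have x0: "x0 \<in> X"
    unfolding X x0_def using l p by (intro periodic_point) auto
  define y where "y = \<pi> x0"
  have y: "y \<in> Y"
    using x0 by (auto simp: Y y_def)
  have y_nth: "y (int l * c + int k) = (v @ w) ! k" if "k < l" for c k
    using that p(3)[OF that] unfolding y_def \<pi>[OF x0] by (simp add: x0_def)
  have arrow: "right_arrow X \<pi> y x x'" if x: "x \<in> fiber X \<pi> y" and x': "x' \<in> fiber X \<pi> y" for x x'
    unfolding right_arrow_def
  proof
    fix m :: int
    \<comment> \<open>A multiple of the period to the right of \<open>m\<close>: the bridge leaves
      \<open>x\<close> only there, at the start of a copy of \<open>v @ w\<close>.\<close>
    define i where "i = int l * (\<bar>m\<bar> + 1)"
    have "1 * (\<bar>m\<bar> + 1) \<le> i"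
      unfolding i_def using l by (intro mult_right_mono) auto
    then have i: "i > m"
      using abs_ge_self[of m] by simp
    have lab: "\<phi> (z j) = y j" if "z \<in> fiber X \<pi> y" for z j
      using that \<pi>[of z] by (auto simp: fiber_def)
    have rel: "(z i, z (i + int l)) \<in> label_rel E \<phi> (v @ w)" if z: "z \<in> fiber X \<pi> y" for z
    proof -
      have "subword (\<lambda>j. \<phi> (z j)) i (length (v @ w)) = v @ w"
        unfolding subword_eq_iff using lab[OF z] y_nth by (simp add: i_def l_def)
      moreover have "z \<in> edge_shift E"
        using z by (auto simp: fiber_def X)
      ultimately show ?thesis
        using subword_label_rel[of z E i l \<phi>] by (simp add: l_def)
    qed
    have "(x i, x' (i + int l)) \<in> label_rel E \<phi> (v @ w)"
      using thru[OF rel[OF x]] thru[OF rel[OF x']] by (auto simp: label_rel_append)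
    moreover have "x \<in> edge_shift E" "x' \<in> edge_shift E"
      using x x' by (auto simp: fiber_def X)
    ultimately obtain z where z: "z \<in> edge_shift E" "\<And>j. j \<le> i \<Longrightarrow> z j = x j"
        "\<And>j. j \<ge> i + int l \<Longrightarrow> z j = x' j" "\<And>k. k < l \<Longrightarrow> \<phi> (z (i + int k)) = (v @ w) ! k"
      using edge_shift_glue[of x E x' i "v @ w" \<phi>] unfolding l_def by metis
    have "\<phi> (z j) = y j" for j
    proof -
      consider "j \<le> i" | "j \<ge> i + int l" | k where "j = i + int k" "k < l"
        by (metis linorder_le_cases linorder_not_le zless_iff_Suc_zadd add_less_cancel_left
            of_nat_less_iff order_le_less zle_iff_zadd)
      then show ?thesis
        using z lab x x' y_nth by cases (auto simp: i_def)
    qed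
    then have "z \<in> fiber X \<pi> y"
      using z(1) \<pi>[of z] by (auto simp: fiber_def X)
    then have "right_bridge X \<pi> y m x x' z"
      unfolding right_bridge_def using i l z(2,3) by (intro conjI exI[of _ "i + int l"]) auto
    then show "\<exists>z. right_bridge X \<pi> y m x x' z"
      by (intro exI[of _ z])
  qed
  have "right_equiv X \<pi> y = fiber X \<pi> y \<times> fiber X \<pi> y"
    using arrow by (auto simp: right_equiv_def)
  then have "right_classes X \<pi> y \<subseteq> {fiber X \<pi> y}"
    by (auto simp: right_classes_def quotient_def)
  then have "finite (right_classes X \<pi> y)" "card (right_classes X \<pi> y) \<le> 1"
    using finite_subset card_mono[of "{fiber X \<pi> y}"] by auto
  then have "num_right_classes X \<pi> y \<le> 1"
    by (simp add: num_right_classes_def one_enat_def)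
  then show ?thesis
    unfolding class_degree_def using y by (rule INF_lower2[rotated])
qed

text \<open>Any \<open>Q \<in> T\<close> with the maximal number of elements related to \<open>a\<close> works: otherwise composing it
  with some \<open>P \<in> T\<close> would add one, and \<open>(a, a) \<in> P\<close> preserves the old ones.\<close>

lemma synchronizing_relation:
  assumes fin: "finite S" and sub: "\<And>Q. Q \<in> T \<Longrightarrow> Q \<subseteq> S \<times> S" and T: "T \<noteq> {}"
    and aa: "\<And>Q. Q \<in> T \<Longrightarrow> (a, a) \<in> Q"
    and step: "\<And>Q r s. Q \<in> T \<Longrightarrow> (r, s) \<in> Q \<Longrightarrow> \<exists>P\<in>T. Q O P \<in> T \<and> (r, a) \<in> Q O P"
  shows "\<exists>Q\<in>T. \<forall>r s. (r, s) \<in> Q \<longrightarrow> (r, a) \<in> Q"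
proof -
  define f where "f Q = card {r. (r, a) \<in> Q}" for Q :: "('a \<times> 'a) set"
  have fS: "{r. (r, a) \<in> Q} \<subseteq> S" if "Q \<in> T" for Q
    using sub[OF that] by auto
  then have "f Q \<le> card S" if "Q \<in> T" for Q
    using that fin by (auto simp: f_def intro: card_mono)
  moreover obtain Q0 where "Q0 \<in> T"
    using T by blast
  ultimately obtain Q where Q: "Q \<in> T" "\<And>P. P \<in> T \<Longrightarrow> f P \<le> f Q"
    using ex_has_greatest_nat[of "\<lambda>Q. Q \<in> T" Q0 f "Suc (card S)"] by (auto simp: less_Suc_eq_le)
  have "(r, a) \<in> Q" if rs: "(r, s) \<in> Q" for r s
  proof (rule ccontr)
    assume r: "(r, a) \<notin> Q"
    obtain P where P: "P \<in> T" "Q O P \<in> T" "(r, a) \<in> Q O P"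
      using step[OF Q(1) rs] by blast
    have "{r. (r, a) \<in> Q} \<subset> {r. (r, a) \<in> Q O P}"
      using r P aa[OF P(1)] by blast
    then have "f Q < f (Q O P)"
      unfolding f_def using fS[OF P(2)] fin by (meson psubset_card_mono finite_subset)
    then show False
      using Q(2)[OF P(2)] by simp
  qed
  with Q(1) show ?thesis
    by blast
qed

text \<open>Let \<open>U\<close> be an idempotent power of the relation of \<open>u\<close>. If
  every nonempty relation \<open>U O R v O U\<close> contained \<open>(a, a)\<close>,
  synchronization applied to these relations and to their converses would give two words such that
  every path over their concatenation can be rerouted through \<open>a\<close> at the joint.
  Repeated periodically, they would make the class degree at most \<open>1\<close>.\<close>

lemma class_degree_gt_1_obstruction:
  assumes X: "X = edge_shift E" and Y: "Y = \<pi> ` X" and \<pi>: "\<And>x. x \<in> X \<Longrightarrow> \<pi> x = (\<lambda>i. \<phi> (x i))"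
    and deg: "class_degree X Y \<pi> > 1"
    and fin: "finite E" and irr: "\<And>s t. s \<in> Field E \<Longrightarrow> t \<in> Field E \<Longrightarrow> (s, t) \<in> E\<^sup>*"
    and u: "(a, a) \<in> label_rel E \<phi> u" "u \<noteq> []"
  obtains v where "\<And>m. label_rel E \<phi> (concat (replicate m u) @ v @ concat (replicate m u)) \<noteq> {}"
    "\<And>i j. (a, a) \<notin> label_rel E \<phi> (concat (replicate i u) @ v @ concat (replicate j u))"
proof -
  define R where "R = label_rel E \<phi>"
  define S where "S = Field E"
  have finS: "finite S"
    using fin by (simp add: S_def finite_Field)
  have RS: "R w \<subseteq> S \<times> S" if "w \<noteq> []" for w
    using that label_rel_subset unfolding R_def S_def by blast
  have R_append: "R (v @ w) = R v O R w" for v w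
    by (simp add: R_def label_rel_append)
  obtain k where k: "k > 0" "R u ^^ k O R u ^^ k = R u ^^ k"
    using finite_relation_idempotent_power[OF finS RS[OF u(2)]] .
  define U where "U = R u ^^ k"
  define b where "b = concat (replicate k u)"
  have b: "R b = U" "b \<noteq> []"
    using k u(2) by (auto simp: R_def U_def b_def relpow_label_rel)
  have UU: "U O U = U"
    using k by (simp add: U_def)
  have U_aa: "(a, a) \<in> R u ^^ i" for i
    by (induction i) (use u(1) in \<open>auto simp: R_def\<close>)
  have "\<exists>v. U O R v O U \<noteq> {} \<and> (a, a) \<notin> U O R v O U"
  proof (rule ccontr)
    assume "\<not> ?thesis"
    then have H: "(a, a) \<in> U O R v O U" if "U O R v O U \<noteq> {}" for v
      using that by blast
    define T where "T = {U O R v O U | v. U O R v O U \<noteq> {}}"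
    have aT: "(a, a) \<in> Q" if "Q \<in> T" for Q
      using H that by (auto simp: T_def)
    have ST: "Q \<subseteq> S \<times> S" if "Q \<in> T" for Q
    proof -
      obtain v where "Q = R (b @ v @ b)"
        using \<open>Q \<in> T\<close> unfolding T_def b(1)[symmetric] by (auto simp: R_append)
      then show ?thesis
        using RS[of "b @ v @ b"] b(2) by simp
    qed
    have conn: "\<exists>w. (s, t) \<in> R w" if "s \<in> S" "t \<in> S" for s t
    proof -
      have "(s, t) \<in> E\<^sup>*"
        using irr that by (auto simp: S_def)
      then obtain n where "(s, t) \<in> E ^^ n"
        by (auto simp: rtrancl_power)
      then obtain p where "p 0 = s" "p n = t" "\<forall>i<n. (p i, p (Suc i)) \<in> E"
        by (auto simp: relpow_fun_conv)
      then show ?thesis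
        using path_label_rel[of n p E \<phi>] by (auto simp: R_def)
    qed
    \<comment> \<open>The inner \<open>U\<close> is the relation of the word \<open>b\<close>, so
      the product has the same form again.\<close>
    have comp: "(U O R v O U) O (U O R w O U) = U O R (v @ b @ w) O U" for v w
      using UU by (simp add: R_append b O_assoc) (metis O_assoc)
    have TT: "(U O R v O U) O (U O R w O U) \<in> T \<and> U O R w O U \<in> T \<and> U O R v O U \<in> T"
      if "(U O R v O U) O (U O R w O U) \<noteq> {}" for v w
    proof -
      have "U O R v O U \<noteq> {}" "U O R w O U \<noteq> {}"
        using that by auto
      then show ?thesis
        using that unfolding T_def comp by blast
    qed
    have aS: "a \<in> S"
      using RS[OF u(2)] u(1) by (auto simp: R_def)
    have "U = U O R [] O U"
      using UU by (simp add: R_def)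
    then have T: "T \<noteq> {}"
      using U_aa[of k] by (auto simp: T_def U_def)
    have aU: "(a, a) \<in> U"
      using U_aa[of k] by (simp add: U_def)
    have step: "\<exists>P\<in>T. Q O P \<in> T \<and> (r, a) \<in> Q O P" if Q: "Q \<in> T" "(r, s) \<in> Q" for Q r s
    proof -
      obtain v where v: "Q = U O R v O U"
        using Q by (auto simp: T_def)
      obtain w where w: "(s, a) \<in> R w"
        using conn[of s a] aS ST[OF Q(1)] Q(2) by blast
      have "Q O (U O R w O U) = Q O R w O U"
        unfolding v O_assoc using UU by (metis O_assoc)
      moreover have "(r, a) \<in> Q O R w O U"
        using Q(2) w aU by (intro relcompI)
      ultimately have ra: "(r, a) \<in> Q O (U O R w O U)"
        by simp
      then have "Q O (U O R w O U) \<in> T \<and> U O R w O U \<in> T"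
        using TT[of v w] unfolding v by force
      then show ?thesis
        using ra by blast
    qed
    have step': "\<exists>P\<in>T. P O Q \<in> T \<and> (a, r) \<in> P O Q" if Q: "Q \<in> T" "(s, r) \<in> Q" for Q r s
    proof -
      obtain v where v: "Q = U O R v O U"
        using Q by (auto simp: T_def)
      obtain w where w: "(a, s) \<in> R w"
        using conn[of a s] aS ST[OF Q(1)] Q(2) by blast
      have "(U O R w O U) O Q = U O R w O Q"
        unfolding v O_assoc using UU by (metis O_assoc)
      moreover have "(a, r) \<in> U O R w O Q"
        using Q(2) w aU by (intro relcompI)
      ultimately have ar: "(a, r) \<in> (U O R w O U) O Q"
        by simp
      then have "(U O R w O U) O Q \<in> T \<and> U O R w O U \<in> T"
        using TT[of w v] unfolding v by force
      then show ?thesis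
        using ar by blast
    qed
    have "\<exists>Q\<in>T. \<forall>r s. (r, s) \<in> Q \<longrightarrow> (r, a) \<in> Q"
      by (rule synchronizing_relation[OF finS ST T]) (simp_all add: aT step)
    then obtain Q where Q: "Q \<in> T" "\<And>r s. (r, s) \<in> Q \<Longrightarrow> (r, a) \<in> Q"
      by blast
    \<comment> \<open>The same argument for reversed paths: here the end symbols are the ones that
      become reachable from \<open>a\<close>.\<close>
    have "\<exists>Q\<in>converse ` T. \<forall>r s. (r, s) \<in> Q \<longrightarrow> (r, a) \<in> Q"
    proof (rule synchronizing_relation[OF finS])
      show "Q \<subseteq> S \<times> S" "(a, a) \<in> Q" if "Q \<in> converse ` T" for Q
        using that ST aT by blast+
      show "converse ` T \<noteq> {}"
        using T by simp
      fix Q r s assume "Q \<in> converse ` T" "(r, s) \<in> Q"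
      then obtain Q0 where Q0: "Q = Q0\<inverse>" "Q0 \<in> T" "(s, r) \<in> Q0"
        by auto
      then obtain P where "P \<in> T" "P O Q0 \<in> T" "(a, r) \<in> P O Q0"
        using step' by blast
      then have "P\<inverse> \<in> converse ` T" "Q O P\<inverse> \<in> converse ` T" "(r, a) \<in> Q O P\<inverse>"
        by (auto simp: Q0(1) simp flip: converse_relcomp)
      then show "\<exists>P\<in>converse ` T. Q O P \<in> converse ` T \<and> (r, a) \<in> Q O P"
        by blast
    qed
    then obtain Q' where Q': "Q' \<in> converse ` T" "\<And>r s. (r, s) \<in> Q' \<Longrightarrow> (r, a) \<in> Q'"
      by blast
    obtain v where v: "Q = R (b @ v @ b)"
      using Q(1) by (auto simp: T_def R_append b)
    obtain w where w: "Q'\<inverse> = R (b @ w @ b)"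
      using Q'(1) by (auto simp: T_def R_append b)
    have "(s, a) \<in> R (b @ v @ b) \<and> (a, t) \<in> R (b @ w @ b)"
      if "(s, t) \<in> R ((b @ v @ b) @ (b @ w @ b))" for s t
    proof -
      have "(s, t) \<in> Q O Q'\<inverse>"
        using that by (simp only: v w R_append)
      then obtain r where "(s, r) \<in> Q" "(t, r) \<in> Q'"
        by auto
      then have "(s, a) \<in> Q" "(t, a) \<in> Q'"
        using Q(2) Q'(2) by blast+
      then show ?thesis
        using v w by (metis converseI)
    qed
    moreover have "(a, a) \<in> R (b @ v @ b)" "(a, a) \<in> R (b @ w @ b)"
      using aT[OF Q(1)] aT Q'(1) w by (auto simp: v)
    ultimately have "class_degree X Y \<pi> \<le> 1"
      using class_degree_le_1[OF X Y \<pi>, of a "b @ v @ b" "b @ w @ b"] b(2) unfolding R_def by auto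
    with deg show False
      by simp
  qed
  then obtain v where v: "U O R v O U \<noteq> {}" "(a, a) \<notin> U O R v O U"
    by blast
  have Uq: "R u ^^ (k * q) = U" if "q > 0" for q
    using that
  proof (induction q)
    case (Suc q)
    then show ?case
      using UU by (cases "q = 0") (auto simp: relpow_add U_def)
  qed simp
  have word: "R (concat (replicate i u) @ v @ concat (replicate j u)) = R u ^^ i O R v O R u ^^ j" for i j
    by (simp add: R_def label_rel_append relpow_label_rel)
  show thesis
  proof (rule that; fold R_def)
    fix m
    \<comment> \<open>\<open>U\<close> is the power with exponent \<open>k * Suc m\<close>, so it
      factors through the power \<open>m\<close> on either side; the inner relation is nonempty
      because the whole product is.\<close>
    have "m \<le> k * Suc m"
      using k(1) by (cases k) auto
    then have "k * Suc m = m + (k * Suc m - m)" "k * Suc m = (k * Suc m - m) + m"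
      by auto
    then have "U = R u ^^ (k * Suc m - m) O R u ^^ m" "U = R u ^^ m O R u ^^ (k * Suc m - m)"
      using Uq[of "Suc m"] by (metis relpow_add zero_less_Suc)+
    then have "U O R v O U = R u ^^ (k * Suc m - m) O (R u ^^ m O R v O R u ^^ m) O R u ^^ (k * Suc m - m)"
      by (metis O_assoc)
    then show "R (concat (replicate m u) @ v @ concat (replicate m u)) \<noteq> {}"
      using v(1) unfolding word by auto
  next
    fix i j
    \<comment> \<open>Loops at \<open>a\<close> would extend a lift from \<open>a\<close> to
      \<open>a\<close> until there are \<open>k * q\<close> copies of \<open>u\<close> on both
      sides, where both powers equal \<open>U\<close>.\<close>
    define q where "q = Suc (i + j)"
    have "i \<le> k * q" "j \<le> k * q"
      using k(1) mult_le_mono1[of 1 k q] by (auto simp: q_def)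
    then have "R u ^^ (k * q - i) O R u ^^ i = U" "R u ^^ j O R u ^^ (k * q - j) = U"
      using Uq[of q] by (simp_all flip: relpow_add add: q_def)
    moreover have "(a, a) \<in> R u ^^ (k * q - i)" "(a, a) \<in> R u ^^ (k * q - j)"
      by (rule U_aa)+
    ultimately show "(a, a) \<notin> R (concat (replicate i u) @ v @ concat (replicate j u))"
      using v(2) unfolding word by blast
  qed
qed

section \<open>Topology and measurability of shift spaces\<close>

lemma topspace_shift_topology [simp]: "topspace (shift_topology X) = X"
  by (simp add: shift_topology_def topspace_subtopology)

text \<open>A basic open box restricts finitely many coordinates, so agreement on a large enough
  window around \<open>0\<close> keeps a point inside it.\<close>

lemma openin_shift_topology:
  "openin (shift_topology X) U \<longleftrightarrow>
     U \<subseteq> X \<and> (\<forall>x\<in>U. \<exists>k. \<forall>z\<in>X. (\<forall>j. \<bar>j\<bar> \<le> int k \<longrightarrow> z j = x j) \<longrightarrow> z \<in> U)"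
proof
  assume "openin (shift_topology X) U"
  then obtain T where T: "openin (product_topology (\<lambda>_. discrete_topology UNIV) UNIV) T" "U = T \<inter> X"
    unfolding shift_topology_def openin_subtopology by blast
  show "U \<subseteq> X \<and> (\<forall>x\<in>U. \<exists>k. \<forall>z\<in>X. (\<forall>j. \<bar>j\<bar> \<le> int k \<longrightarrow> z j = x j) \<longrightarrow> z \<in> U)"
  proof (intro conjI ballI)
    show "U \<subseteq> X" using T by blast
    fix x assume x: "x \<in> U"
    then obtain V where V: "finite {i. V i \<noteq> UNIV}" "x \<in> Pi\<^sub>E UNIV V" "Pi\<^sub>E UNIV V \<subseteq> T"
      using T unfolding openin_product_topology_alt by auto
    define k where "k = nat (Max (insert 0 (abs ` {i. V i \<noteq> UNIV})))"
    have k: "\<bar>i\<bar> \<le> int k" if "V i \<noteq> UNIV" for i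
    proof -
      have "\<bar>i\<bar> \<le> Max (insert 0 (abs ` {i. V i \<noteq> UNIV}))"
        using that V(1) by (intro Max_ge) auto
      also have "\<dots> \<le> int k"
        unfolding k_def by simp
      finally show ?thesis .
    qed
    show "\<exists>k. \<forall>z\<in>X. (\<forall>j. \<bar>j\<bar> \<le> int k \<longrightarrow> z j = x j) \<longrightarrow> z \<in> U"
    proof (intro exI[of _ k] ballI impI)
      fix z assume z: "z \<in> X" "\<forall>j. \<bar>j\<bar> \<le> int k \<longrightarrow> z j = x j"
      have "z i \<in> V i" for i
        using V(2) z(2) k[of i] by (cases "V i = UNIV") (auto simp: PiE_iff)
      then have "z \<in> T"
        using V(3) by auto
      with z T show "z \<in> U" by blast
    qed
  qed
next
  assume U: "U \<subseteq> X \<and> (\<forall>x\<in>U. \<exists>k. \<forall>z\<in>X. (\<forall>j. \<bar>j\<bar> \<le> int k \<longrightarrow> z j = x j) \<longrightarrow> z \<in> U)"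
  define T where "T = {z. \<exists>x\<in>U. \<exists>k. (\<forall>j. \<bar>j\<bar> \<le> int k \<longrightarrow> z j = x j) \<and>
      (\<forall>z\<in>X. (\<forall>j. \<bar>j\<bar> \<le> int k \<longrightarrow> z j = x j) \<longrightarrow> z \<in> U)}"
  have "openin (product_topology (\<lambda>_. discrete_topology UNIV) UNIV) T"
    unfolding openin_product_topology_alt
  proof
    fix z assume "z \<in> T"
    then obtain x k where x: "x \<in> U" "\<forall>j. \<bar>j\<bar> \<le> int k \<longrightarrow> z j = x j"
        "\<forall>z\<in>X. (\<forall>j. \<bar>j\<bar> \<le> int k \<longrightarrow> z j = x j) \<longrightarrow> z \<in> U"
      unfolding T_def by blast
    define V where "V = (\<lambda>i. if \<bar>i\<bar> \<le> int k then {z i} else UNIV)"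
    have "{i. V i \<noteq> UNIV} \<subseteq> {- int k..int k}"
      by (auto simp: V_def)
    then have "finite {i. V i \<noteq> UNIV}"
      by (rule finite_subset) simp
    moreover have "Pi\<^sub>E UNIV V \<subseteq> T"
    proof
      fix z' assume "z' \<in> Pi\<^sub>E UNIV V"
      then have "z' i \<in> V i" for i
        by auto
      then have "z' i = z i" if "\<bar>i\<bar> \<le> int k" for i
        using that by (metis V_def singletonD)
      then show "z' \<in> T"
        using x unfolding T_def by auto
    qed
    moreover have "z \<in> Pi\<^sub>E UNIV V"
      by (auto simp: V_def)
    ultimately show "\<exists>V. finite {i \<in> UNIV. V i \<noteq> topspace (discrete_topology UNIV)} \<and>
        (\<forall>i\<in>UNIV. openin (discrete_topology UNIV) (V i)) \<and> z \<in> Pi\<^sub>E UNIV V \<and> Pi\<^sub>E UNIV V \<subseteq> T"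
      by (intro exI[of _ V]) auto
  qed
  moreover have "U = T \<inter> X"
    using U unfolding T_def by fast
  ultimately show "openin (shift_topology X) U"
    unfolding shift_topology_def openin_subtopology by blast
qed

text \<open>The radius may depend on the coordinate: a neighbourhood of the image tests finitely
  many coordinates, and their maximal radius serves for all of them.\<close>

lemma continuous_map_shift_topology:
  assumes \<theta>: "\<And>x. x \<in> X \<Longrightarrow> \<theta> x \<in> Y"
    and loc: "\<And>i. \<exists>r. \<forall>x\<in>X. \<forall>z\<in>X. (\<forall>j. \<bar>j\<bar> \<le> int r \<longrightarrow> z j = x j) \<longrightarrow> \<theta> z i = \<theta> x i"
  shows "continuous_map (shift_topology X) (shift_topology Y) \<theta>"
  unfolding continuous_map_def
proof (intro conjI allI impI)
  show "\<theta> \<in> topspace (shift_topology X) \<rightarrow> topspace (shift_topology Y)"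
    using \<theta> by simp
  fix U assume U: "openin (shift_topology Y) U"
  obtain r where r: "\<And>i x z. x \<in> X \<Longrightarrow> z \<in> X \<Longrightarrow> \<forall>j. \<bar>j\<bar> \<le> int (r i) \<longrightarrow> z j = x j \<Longrightarrow> \<theta> z i = \<theta> x i"
    using loc by metis
  show "openin (shift_topology X) {x \<in> topspace (shift_topology X). \<theta> x \<in> U}"
    unfolding openin_shift_topology topspace_shift_topology
  proof (intro conjI ballI)
    fix x assume x: "x \<in> {x \<in> X. \<theta> x \<in> U}"
    then obtain k where k: "\<And>y. y \<in> Y \<Longrightarrow> \<forall>j. \<bar>j\<bar> \<le> int k \<longrightarrow> y j = \<theta> x j \<Longrightarrow> y \<in> U"
      using U unfolding openin_shift_topology by blast
    define m where "m = Max (r ` {- int k..int k})"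
    have m: "r i \<le> m" if "\<bar>i\<bar> \<le> int k" for i
      using that unfolding m_def by (intro Max_ge imageI) auto
    show "\<exists>m. \<forall>z\<in>X. (\<forall>j. \<bar>j\<bar> \<le> int m \<longrightarrow> z j = x j) \<longrightarrow> z \<in> {x \<in> X. \<theta> x \<in> U}"
    proof (intro exI[of _ m] ballI impI)
      fix z assume z: "z \<in> X" "\<forall>j. \<bar>j\<bar> \<le> int m \<longrightarrow> z j = x j"
      have "\<theta> z i = \<theta> x i" if "\<bar>i\<bar> \<le> int k" for i
        using m[OF that] z x by (intro r) auto
      then show "z \<in> {x \<in> X. \<theta> x \<in> U}"
        using k[OF \<theta>[OF z(1)]] z(1) by blast
    qed
  qed auto
qed

lemma continuous_map_shift_map: "continuous_map (shift_topology X) (shift_topology (shift_map ` X)) shift_map"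
proof (rule continuous_map_shift_topology)
  fix i :: int
  show "\<exists>r. \<forall>x\<in>X. \<forall>z\<in>X. (\<forall>j. \<bar>j\<bar> \<le> int r \<longrightarrow> z j = x j) \<longrightarrow> shift_map z i = shift_map x i"
    by (intro exI[of _ "nat \<bar>i + 1\<bar>"]) (auto simp: shift_map_def)
qed simp

section \<open>Borel sets and the cylinders that generate them\<close>

lemma openin_shift_topology_Pow: "{U. openin (shift_topology X) U} \<subseteq> Pow X"
  using openin_subset[of "shift_topology X"] by auto

lemma space_borel_shift [simp]: "space (borel_shift X) = X"
  unfolding borel_shift_def by (rule space_measure_of[OF openin_shift_topology_Pow])

lemma sets_borel_shift: "sets (borel_shift X) = sigma_sets X {U. openin (shift_topology X) U}"
  unfolding borel_shift_def by (rule sets_measure_of[OF openin_shift_topology_Pow])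

lemma measurable_borel_shift:
  assumes "continuous_map (shift_topology X) (shift_topology Y) \<theta>"
  shows "\<theta> \<in> measurable (borel_shift X) (borel_shift Y)"
  unfolding borel_shift_def[of Y]
proof (rule measurable_measure_of[OF openin_shift_topology_Pow])
  show "\<theta> \<in> space (borel_shift X) \<rightarrow> Y"
    using assms by (auto simp: continuous_map_def)
  fix U assume "U \<in> {U. openin (shift_topology Y) U}"
  then have "openin (shift_topology X) {x \<in> X. \<theta> x \<in> U}"
    using assms by (auto simp: continuous_map_def)
  moreover have "\<theta> -` U \<inter> space (borel_shift X) = {x \<in> X. \<theta> x \<in> U}"
    by auto
  ultimately show "\<theta> -` U \<inter> space (borel_shift X) \<in> sets (borel_shift X)"
    by (simp add: sets_borel_shift)
qed

lemma openin_cylinder: "openin (shift_topology X) (cylinder X w i)"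
  unfolding openin_shift_topology
proof (intro conjI ballI)
  fix x assume x: "x \<in> cylinder X w i"
  show "\<exists>k. \<forall>z\<in>X. (\<forall>j. \<bar>j\<bar> \<le> int k \<longrightarrow> z j = x j) \<longrightarrow> z \<in> cylinder X w i"
  proof (intro exI[of _ "nat \<bar>i\<bar> + length w"] ballI impI)
    fix z assume z: "z \<in> X" "\<forall>j. \<bar>j\<bar> \<le> int (nat \<bar>i\<bar> + length w) \<longrightarrow> z j = x j"
    have "z (i + int k) = x (i + int k)" if "k < length w" for k
      using that z(2) by auto
    then show "z \<in> cylinder X w i"
      using x z(1) by (auto simp: cylinder_def subword_eq_iff)
  qed
qed (auto simp: cylinder_def)

lemma cylinder_in_sets: "cylinder X w i \<in> sets (borel_shift X)"
  using openin_cylinder by (auto simp: sets_borel_shift)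

text \<open>The empty set makes the family closed under intersections. With \<open>k > 0\<close> the
  window still contains time \<open>0\<close> after one shift, which is where the chain is
  started.\<close>

definition centered_cylinders :: "'a set \<Rightarrow> 'a point set \<Rightarrow> 'a point set set" where
  "centered_cylinders A X =
     insert {} {cylinder X w (- int k) | w k. set w \<subseteq> A \<and> length w = 2 * k + 1 \<and> k > 0}"

lemma mem_centered_cylinder:
  assumes "length w = 2 * k + 1"
  shows "z \<in> cylinder X w (- int k) \<longleftrightarrow> z \<in> X \<and> (\<forall>j. \<bar>j\<bar> \<le> int k \<longrightarrow> z j = w ! nat (j + int k))"
proof -
  have "(\<forall>m<length w. z (- int k + int m) = w ! m) \<longleftrightarrow> (\<forall>j. \<bar>j\<bar> \<le> int k \<longrightarrow> z j = w ! nat (j + int k))"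
  proof safe
    fix j :: int assume H: "\<forall>m<length w. z (- int k + int m) = w ! m" "\<bar>j\<bar> \<le> int k"
    then have "nat (j + int k) < length w"
      using assms by auto
    then have "z (- int k + int (nat (j + int k))) = w ! nat (j + int k)"
      using H by blast
    moreover have "- int k + int (nat (j + int k)) = j"
      using H(2) by simp
    ultimately show "z j = w ! nat (j + int k)"
      by simp
  next
    fix m assume H: "\<forall>j. \<bar>j\<bar> \<le> int k \<longrightarrow> z j = w ! nat (j + int k)" "m < length w"
    have "\<bar>- int k + int m\<bar> \<le> int k"
      using H(2) assms by auto
    then have "z (- int k + int m) = w ! nat ((- int k + int m) + int k)"
      using H(1) by blast
    then show "z (- int k + int m) = w ! m"
      by simp
  qed
  then show ?thesis
    by (simp add: cylinder_def subword_eq_iff)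
qed

lemma centered_cylinder_of_point:
  assumes "x \<in> X" "X \<subseteq> full_shift A" "k > 0"
  shows "cylinder X (subword x (- int k) (2 * k + 1)) (- int k) \<in> centered_cylinders A X"
    and "z \<in> cylinder X (subword x (- int k) (2 * k + 1)) (- int k) \<longleftrightarrow>
      z \<in> X \<and> (\<forall>j. \<bar>j\<bar> \<le> int k \<longrightarrow> z j = x j)"
proof -
  have "set (subword x (- int k) (2 * k + 1)) \<subseteq> A"
    using assms by (auto simp: subword_def full_shift_def)
  then show "cylinder X (subword x (- int k) (2 * k + 1)) (- int k) \<in> centered_cylinders A X"
    using assms(3) unfolding centered_cylinders_def
    by (intro insertI2 CollectI exI[of _ "subword x (- int k) (2 * k + 1)"] exI[of _ k]) simp
  show "z \<in> cylinder X (subword x (- int k) (2 * k + 1)) (- int k) \<longleftrightarrow>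
      z \<in> X \<and> (\<forall>j. \<bar>j\<bar> \<le> int k \<longrightarrow> z j = x j)"
    by (subst mem_centered_cylinder) auto
qed

lemma countable_centered_cylinders:
  assumes "finite A"
  shows "countable (centered_cylinders A X)"
proof -
  have "centered_cylinders A X \<subseteq> insert {} ((\<lambda>(w, k). cylinder X w (- int k)) ` (lists A \<times> (UNIV :: nat set)))"
    by (fastforce simp: centered_cylinders_def)
  moreover have "countable (lists A)"
    using assms by (simp add: countable_finite)
  then have "countable (insert {} ((\<lambda>(w, k). cylinder X w (- int k)) ` (lists A \<times> (UNIV :: nat set))))"
    by (intro countable_insert countable_image countable_SIGMA) auto
  ultimately show ?thesis
    by (rule countable_subset)
qed

lemma Union_centered_cylinders:
  assumes "X \<subseteq> full_shift A"
  shows "\<Union> (centered_cylinders A X) = X"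
proof
  show "X \<subseteq> \<Union> (centered_cylinders A X)"
  proof
    fix x assume "x \<in> X"
    then show "x \<in> \<Union> (centered_cylinders A X)"
      using centered_cylinder_of_point[OF _ assms zero_less_one] by blast
  qed
qed (auto simp: centered_cylinders_def cylinder_def)

text \<open>Over a finite alphabet there are countably many cylinders, so an open set is the
  countable union of the centered cylinders inside it.\<close>

lemma sets_borel_shift_cylinders:
  assumes "finite A" "X \<subseteq> full_shift A"
  shows "sets (borel_shift X) = sigma_sets X (centered_cylinders A X)"
  unfolding sets_borel_shift
proof
  show "sigma_sets X (centered_cylinders A X) \<subseteq> sigma_sets X {U. openin (shift_topology X) U}"
    by (rule sigma_sets_mono') (auto simp: centered_cylinders_def openin_cylinder)
  have "U \<in> sigma_sets X (centered_cylinders A X)" if U: "openin (shift_topology X) U" for U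
  proof -
    define C where "C = {V \<in> centered_cylinders A X. V \<subseteq> U}"
    have "U \<subseteq> \<Union> C"
    proof
      fix x assume x: "x \<in> U"
      then obtain k where k: "\<And>z. z \<in> X \<Longrightarrow> \<forall>j. \<bar>j\<bar> \<le> int k \<longrightarrow> z j = x j \<Longrightarrow> z \<in> U"
        using U unfolding openin_shift_topology by blast
      have xX: "x \<in> X"
        using U x by (auto simp: openin_shift_topology)
      define V where "V = cylinder X (subword x (- int (Suc k)) (2 * Suc k + 1)) (- int (Suc k))"
      have V: "V \<in> centered_cylinders A X" "\<And>z. z \<in> V \<longleftrightarrow> z \<in> X \<and> (\<forall>j. \<bar>j\<bar> \<le> int (Suc k) \<longrightarrow> z j = x j)"
        unfolding V_def by (rule centered_cylinder_of_point[OF xX assms(2)]; simp)+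
      then have "V \<subseteq> U" "x \<in> V"
        using k xX by auto
      with V(1) show "x \<in> \<Union> C"
        by (auto simp: C_def)
    qed
    then have "U = \<Union> C"
      by (auto simp: C_def)
    moreover have "countable C"
      unfolding C_def by (rule countable_subset[OF _ countable_centered_cylinders[OF assms(1), of X]]) auto
    ultimately show ?thesis
      by (metis (no_types, lifting) C_def mem_Collect_eq sigma_sets.Basic sigma_sets_UNION)
  qed
  then show "sigma_sets X {U. openin (shift_topology X) U} \<subseteq> sigma_sets X (centered_cylinders A X)"
    by (intro sigma_sets_mono) auto
qed

text \<open>Windows around \<open>0\<close> are ordered by inclusion, so two centered cylinders are
  nested or disjoint.\<close>

lemma Int_stable_centered_cylinders: "Int_stable (centered_cylinders A X)"
proof -
  have "cylinder X w (- int k) \<inter> cylinder X w' (- int k') \<in> {{}, cylinder X w (- int k)}"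
    if "length w = 2 * k + 1" "length w' = 2 * k' + 1" "k' \<le> k" for w w' k k'
  proof (cases "\<exists>z. z \<in> cylinder X w (- int k) \<inter> cylinder X w' (- int k')")
    case True
    then obtain z where "z \<in> cylinder X w (- int k)" "z \<in> cylinder X w' (- int k')"
      by blast
    then have z: "\<And>j. \<bar>j\<bar> \<le> int k \<Longrightarrow> z j = w ! nat (j + int k)"
        "\<And>j. \<bar>j\<bar> \<le> int k' \<Longrightarrow> z j = w' ! nat (j + int k')"
      unfolding mem_centered_cylinder[OF that(1)] mem_centered_cylinder[OF that(2)] by blast+
    have "cylinder X w (- int k) \<subseteq> cylinder X w' (- int k')"
    proof
      fix x assume "x \<in> cylinder X w (- int k)"
      then have x: "x \<in> X" "\<And>j. \<bar>j\<bar> \<le> int k \<Longrightarrow> x j = z j"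
        unfolding mem_centered_cylinder[OF that(1)] using z(1) by auto
      have "x j = w' ! nat (j + int k')" if "\<bar>j\<bar> \<le> int k'" for j
        using x(2)[of j] z(2)[of j] that \<open>k' \<le> k\<close> by simp
      then show "x \<in> cylinder X w' (- int k')"
        unfolding mem_centered_cylinder[OF that(2)] using x(1) by blast
    qed
    then show ?thesis by blast
  qed blast
  note * = this
  show ?thesis
  proof (rule Int_stableI)
    fix U V assume UV: "U \<in> centered_cylinders A X" "V \<in> centered_cylinders A X"
    show "U \<inter> V \<in> centered_cylinders A X"
    proof (cases "U = {} \<or> V = {}")
      case True
      then show ?thesis by (auto simp: centered_cylinders_def)
    next
      case False
      then obtain w k w' k' where w: "U = cylinder X w (- int k)" "length w = 2 * k + 1"
          "V = cylinder X w' (- int k')" "length w' = 2 * k' + 1"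
        using UV by (auto simp: centered_cylinders_def)
      then have "U \<inter> V \<in> {{}, U, V}"
        using *[of w k w' k'] *[of w' k' w k] by (cases "k' \<le> k") (auto simp: Int_commute)
      then show ?thesis
        using UV by (auto simp: centered_cylinders_def)
    qed
  qed
qed

section \<open>Stationary two-sided Markov chains\<close>

text \<open>Induction on the number of states: eliminating a state \<open>k\<close> means watching the chain only at
  the times when it is not in \<open>k\<close>.\<close>

lemma stationary_distribution_exists:
  fixes P :: "'s \<Rightarrow> 's \<Rightarrow> real"
  assumes "finite S" "S \<noteq> {}" "\<And>s t. s \<in> S \<Longrightarrow> t \<in> S \<Longrightarrow> 0 \<le> P s t"
    "\<And>s. s \<in> S \<Longrightarrow> (\<Sum>t\<in>S. P s t) = 1"
  shows "\<exists>p. (\<forall>s\<in>S. 0 \<le> p s) \<and> (\<Sum>s\<in>S. p s) = 1 \<and> (\<forall>t\<in>S. (\<Sum>s\<in>S. p s * P s t) = p t)"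
  using assms
proof (induction S arbitrary: P rule: finite_ne_induct)
  case (singleton k)
  then show ?case
    by (intro exI[of _ "\<lambda>_. 1"]) auto
next
  case (insert k S)
  have row: "P s k + (\<Sum>t\<in>S. P s t) = 1" if "s \<in> insert k S" for s
    using insert.prems(2)[OF that] insert.hyps by simp
  have nn: "0 \<le> P s t" if "s \<in> insert k S" "t \<in> insert k S" for s t
    using insert.prems(1) that .
  show ?case
  proof (cases "P k k = 1")
    case True
    then have "(\<Sum>t\<in>S. P k t) = 0"
      using row[of k] by simp
    then have "P k t = 0" if "t \<in> S" for t
      using that nn insert.hyps(1) by (subst (asm) sum_nonneg_eq_0_iff) auto
    then show ?thesis
      using True insert.hyps
      by (intro exI[of _ "\<lambda>s. if s = k then 1 else 0"]) (auto simp: sum.If_cases if_distrib if_distribR)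
  next
    case False
    define d where "d = 1 - P k k"
    have d: "d > 0"
      using False row[of k] sum_nonneg[of S "P k"] nn by (simp add: d_def)
    \<comment> \<open>A stay in \<open>k\<close> has geometric length; summing the series gives
      \<open>1 / d\<close>, where \<open>d\<close> is the probability of leaving
      \<open>k\<close>.\<close>
    define Q where "Q s t = P s t + P s k * P k t / d" for s t
    have "(\<Sum>t\<in>S. Q s t) = 1" if "s \<in> S" for s
    proof -
      have "(\<Sum>t\<in>S. Q s t) = (\<Sum>t\<in>S. P s t) + P s k * (\<Sum>t\<in>S. P k t) / d"
        by (simp add: Q_def sum.distrib sum_distrib_left sum_divide_distrib)
      moreover have "(\<Sum>t\<in>S. P k t) = d"
        using row[of k] by (simp add: d_def)
      ultimately show ?thesis
        using row[of s] that d by simp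
    qed
    moreover have "0 \<le> Q s t" if "s \<in> S" "t \<in> S" for s t
      using nn that d by (simp add: Q_def)
    ultimately obtain q where q: "\<forall>s\<in>S. 0 \<le> q s" "(\<Sum>s\<in>S. q s) = 1"
        "\<forall>t\<in>S. (\<Sum>s\<in>S. q s * Q s t) = q t"
      using insert.IH[of Q] by blast
    \<comment> \<open>The mass of \<open>k\<close> before normalization, solved from the balance at
      \<open>k\<close>: the inflow from \<open>S\<close> equals the outflow
      \<open>c * d\<close>.\<close>
    define c where "c = (\<Sum>s\<in>S. q s * P s k) / d"
    have c: "c \<ge> 0"
      unfolding c_def using q(1) nn d by (intro divide_nonneg_pos sum_nonneg mult_nonneg_nonneg) auto
    define p where "p s = (if s = k then c else q s) / (1 + c)" for s
    have sum_p: "(\<Sum>s\<in>insert k S. p s * f s) = (c * f k + (\<Sum>s\<in>S. q s * f s)) / (1 + c)" for f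
    proof -
      have "(\<Sum>s\<in>S. p s * f s) = (\<Sum>s\<in>S. q s * f s) / (1 + c)"
        unfolding sum_divide_distrib using insert.hyps(3) by (intro sum.cong) (auto simp: p_def)
      then show ?thesis
        using insert.hyps by (simp add: p_def add_divide_distrib)
    qed
    have "(\<Sum>s\<in>insert k S. p s) = 1"
      using sum_p[of "\<lambda>_. 1"] q(2) c by simp
    moreover have "(\<Sum>s\<in>insert k S. p s * P s t) = p t" if t: "t \<in> insert k S" for t
    proof (cases "t = k")
      case True
      have "c * P k k + (\<Sum>s\<in>S. q s * P s k) = c"
        using d by (simp add: c_def d_def field_simps)
      then show ?thesis
        unfolding sum_p by (simp add: True p_def)
    next
      case False
      then have "q t = (\<Sum>s\<in>S. q s * Q s t)"
        using q(3) t by simp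
      also have "\<dots> = (\<Sum>s\<in>S. q s * P s t) + c * P k t"
        by (simp add: Q_def c_def algebra_simps sum.distrib sum_distrib_left sum_divide_distrib)
      finally show ?thesis
        unfolding sum_p using False by (simp add: p_def)
    qed
    moreover have "0 \<le> p s" if "s \<in> insert k S" for s
      using that q(1) c by (auto simp: p_def)
    ultimately show ?thesis
      by blast
  qed
qed

section \<open>Two-sided chains from independent choices\<close>

locale markov_chain =
  fixes S :: "'s set" and P :: "'s \<Rightarrow> 's \<Rightarrow> real" and p :: "'s \<Rightarrow> real"
  assumes finite_states: "finite S"
    and P_nonneg: "0 \<le> P s t"
    and P_outside: "s \<notin> S \<or> t \<notin> S \<Longrightarrow> P s t = 0"
    and P_row: "s \<in> S \<Longrightarrow> (\<Sum>t\<in>S. P s t) = 1"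
    and p_pos: "s \<in> S \<Longrightarrow> 0 < p s"
    and p_sum: "(\<Sum>s\<in>S. p s) = 1"
    and stationary: "t \<in> S \<Longrightarrow> (\<Sum>s\<in>S. p s * P s t) = p t"
begin

definition edges :: "('s \<times> 's) set" where
  "edges = {(s, t). 0 < P s t}"

definition word_weight :: "'s list \<Rightarrow> real" where
  "word_weight w = p (hd w) * (\<Prod>i<length w - 1. P (w ! i) (w ! Suc i))"

lemma edges_subset: "edges \<subseteq> S \<times> S"
  unfolding edges_def using P_outside less_irrefl by (auto, metis+)

text \<open>The chain is run forwards and backwards in time from a random state at time \<open>0\<close>. The
  coordinate \<open>None\<close> is that state; \<open>Some (i, s)\<close> is the state at time \<open>i + 1\<close> if the state at
  time \<open>i \<ge> 0\<close> is \<open>s\<close>, and the state at time \<open>i\<close> if the state at time \<open>i + 1 \<le> 0\<close> is \<open>s\<close>.\<close>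

definition choices :: "(int \<times> 's) option \<Rightarrow> 's set" where
  "choices c = (case c of None \<Rightarrow> S | Some (i, s) \<Rightarrow>
     if s \<notin> S then S else if i \<ge> 0 then {t. 0 < P s t} else {t. 0 < P t s})"

text \<open>Negative times use the time-reversed kernel. A state outside \<open>S\<close> is never
  met; the distribution \<open>p\<close> given there only keeps every factor a probability
  space.\<close>

definition choice_prob :: "(int \<times> 's) option \<Rightarrow> 's \<Rightarrow> real" where
  "choice_prob c t = (case c of None \<Rightarrow> p t | Some (i, s) \<Rightarrow>
     if s \<notin> S then p t else if i \<ge> 0 then P s t else p t * P t s / p s)"

definition choice_measure :: "(int \<times> 's) option \<Rightarrow> 's measure" where
  "choice_measure c = point_measure (choices c) (\<lambda>t. ennreal (choice_prob c t))"

lemma choices_subset: "choices c \<subseteq> S"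
  using edges_subset by (auto simp: choices_def edges_def split: option.splits if_splits)

lemma finite_choices: "finite (choices c)"
  using choices_subset finite_states by (rule finite_subset)

lemma p_nonneg: "s \<in> S \<Longrightarrow> 0 \<le> p s"
  using p_pos by fastforce

lemma choice_prob_nonneg: "t \<in> S \<Longrightarrow> 0 \<le> choice_prob c t"
  using P_nonneg p_nonneg by (auto simp: choice_prob_def split: option.splits if_splits)

lemma choice_prob_eq_0: "t \<in> S \<Longrightarrow> t \<notin> choices c \<Longrightarrow> choice_prob c t = 0"
  using P_nonneg by (auto simp: choice_prob_def choices_def split: option.splits if_splits
      intro: antisym)

lemma sum_choice_prob: "(\<Sum>t\<in>choices c. choice_prob c t) = 1"
proof -
  have "(\<Sum>t\<in>choices c. choice_prob c t) = (\<Sum>t\<in>S. choice_prob c t)"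
    using choices_subset finite_states choice_prob_eq_0 by (intro sum.mono_neutral_left) auto
  also have "\<dots> = 1"
  proof (cases c)
    case None
    then show ?thesis by (simp add: choice_prob_def p_sum)
  next
    case (Some x)
    obtain i s where x: "x = (i, s)" by (cases x)
    show ?thesis
    proof (cases "s \<in> S")
      case True
      then have "(\<Sum>t\<in>S. p t * P t s / p s) = 1"
        using p_pos[of s] by (simp add: stationary flip: sum_divide_distrib)
      then show ?thesis
        using True P_row by (cases "i \<ge> 0") (simp_all add: choice_prob_def Some x)
    next
      case False
      then show ?thesis by (simp add: choice_prob_def Some x p_sum)
    qed
  qed
  finally show ?thesis .
qed

lemma prob_space_choice: "prob_space (choice_measure c)"
proof (rule prob_spaceI)
  have "(\<Sum>t\<in>choices c. ennreal (choice_prob c t)) = ennreal (\<Sum>t\<in>choices c. choice_prob c t)"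
    using choices_subset choice_prob_nonneg by (intro sum_ennreal) auto
  then show "emeasure (choice_measure c) (space (choice_measure c)) = 1"
    unfolding choice_measure_def
    by (simp add: space_point_measure emeasure_point_measure_finite finite_choices sum_choice_prob)
qed

lemma emeasure_choice:
  assumes "t \<in> S"
  shows "emeasure (choice_measure c) ({t} \<inter> choices c) = ennreal (choice_prob c t)"
proof (cases "t \<in> choices c")
  case True
  then have "{t} \<inter> choices c = {t}" by blast
  then show ?thesis
    unfolding choice_measure_def using True by (simp add: emeasure_point_measure_finite finite_choices)
next
  case False
  then have "{t} \<inter> choices c = {}" by blast
  then show ?thesis
    using choice_prob_eq_0[OF assms False] by simp
qed

sublocale choice: product_prob_space choice_measure UNIV
  by (simp add: product_prob_space_def product_prob_space_axioms_def product_sigma_finite_def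
      prob_space_choice prob_space_imp_sigma_finite)

abbreviation "choice_space \<equiv> Pi\<^sub>M UNIV choice_measure"

lemma choice_mem: "\<omega> \<in> space choice_space \<Longrightarrow> \<omega> c \<in> choices c"
  by (auto simp: space_PiM choice_measure_def space_point_measure PiE_iff)

primrec forward :: "((int \<times> 's) option \<Rightarrow> 's) \<Rightarrow> nat \<Rightarrow> 's" where
  "forward \<omega> 0 = \<omega> None"
| "forward \<omega> (Suc k) = \<omega> (Some (int k, forward \<omega> k))"

primrec backward :: "((int \<times> 's) option \<Rightarrow> 's) \<Rightarrow> nat \<Rightarrow> 's" where
  "backward \<omega> 0 = \<omega> None"
| "backward \<omega> (Suc k) = \<omega> (Some (- 1 - int k, backward \<omega> k))"

definition trajectory :: "((int \<times> 's) option \<Rightarrow> 's) \<Rightarrow> 's point" where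
  "trajectory \<omega> i = (if i \<ge> 0 then forward \<omega> (nat i) else backward \<omega> (nat (- i)))"

lemma trajectory_int [simp]: "trajectory \<omega> (int k) = forward \<omega> k"
  by (simp add: trajectory_def)

lemma trajectory_neg_int [simp]: "trajectory \<omega> (- int k) = backward \<omega> k"
  by (cases "k = 0") (simp_all add: trajectory_def)

text \<open>The factors are carried by the choices of positive probability, so this holds for every
  \<omega> of the space and not only almost surely.\<close>

lemma trajectory_in_edge_shift:
  assumes "\<omega> \<in> space choice_space"
  shows "trajectory \<omega> \<in> edge_shift edges"
proof -
  have S: "\<omega> c \<in> S" for c
    using choice_mem[OF assms] choices_subset by blast
  have fS: "forward \<omega> k \<in> S" and bS: "backward \<omega> k \<in> S" for k
    by (cases k; simp add: S)+
  have "(trajectory \<omega> i, trajectory \<omega> (i + 1)) \<in> edges" for i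
  proof (cases i rule: int_cases)
    case (nonneg k)
    have "trajectory \<omega> (i + 1) = forward \<omega> (Suc k)"
      using trajectory_int[of \<omega> "Suc k"] by (simp add: nonneg add.commute)
    then show ?thesis
      using choice_mem[OF assms, of "Some (int k, forward \<omega> k)"] fS[of k]
      by (simp add: nonneg choices_def edges_def)
  next
    case (neg k)
    have "i + 1 = - int k"
      using neg by simp
    then have "trajectory \<omega> (i + 1) = backward \<omega> k"
      by simp
    moreover have "trajectory \<omega> i = backward \<omega> (Suc k)"
      unfolding neg by (rule trajectory_neg_int)
    ultimately show ?thesis
      using choice_mem[OF assms, of "Some (- 1 - int k, backward \<omega> k)"] bS[of k]
      by (simp add: choices_def edges_def)
  qed
  then show ?thesis
    by (simp add: edge_shift_def)
qed

text \<open>Which coordinates a trajectory reads depends on its states. Along a prescribed word they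
  are fixed and distinct, so following the word is a finite product event.\<close>

definition window_index :: "'s list \<Rightarrow> nat \<Rightarrow> nat \<Rightarrow> (int \<times> 's) option set" where
  "window_index w k l = insert None ((\<lambda>j. Some (int j, w ! (k + j))) ` {..<l} \<union>
     (\<lambda>j. Some (- 1 - int j, w ! (k - j))) ` {..<k})"

definition window_value :: "'s list \<Rightarrow> nat \<Rightarrow> (int \<times> 's) option \<Rightarrow> 's" where
  "window_value w k c = (case c of None \<Rightarrow> w ! k | Some (i, s) \<Rightarrow>
     if i \<ge> 0 then w ! Suc (k + nat i) else w ! (k - nat (- i)))"

lemma trajectory_window:
  assumes w: "length w = k + l + 1"
  shows "subword (trajectory \<omega>) (- int k) (length w) = w \<longleftrightarrow>
    (\<forall>c\<in>window_index w k l. \<omega> c = window_value w k c)"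
proof -
  have fw: "(\<forall>j\<le>m. forward \<omega> j = w ! (k + j)) \<longleftrightarrow>
      \<omega> None = w ! k \<and> (\<forall>j<m. \<omega> (Some (int j, w ! (k + j))) = w ! Suc (k + j))" for m
  proof (induction m)
    case (Suc m)
    have "(\<forall>j\<le>Suc m. forward \<omega> j = w ! (k + j)) \<longleftrightarrow>
        (\<forall>j\<le>m. forward \<omega> j = w ! (k + j)) \<and> forward \<omega> (Suc m) = w ! (k + Suc m)"
      by (metis le_Suc_eq)
    then show ?case
      using Suc by (auto simp: less_Suc_eq)
  qed auto
  have bw: "(\<forall>j\<le>m. backward \<omega> j = w ! (k - j)) \<longleftrightarrow>
      \<omega> None = w ! k \<and> (\<forall>j<m. \<omega> (Some (- 1 - int j, w ! (k - j))) = w ! (k - Suc j))" for m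
  proof (induction m)
    case (Suc m)
    have "(\<forall>j\<le>Suc m. backward \<omega> j = w ! (k - j)) \<longleftrightarrow>
        (\<forall>j\<le>m. backward \<omega> j = w ! (k - j)) \<and> backward \<omega> (Suc m) = w ! (k - Suc m)"
      by (metis le_Suc_eq)
    then show ?case
      using Suc by (auto simp: less_Suc_eq)
  qed auto
  have "subword (trajectory \<omega>) (- int k) (length w) = w \<longleftrightarrow>
      (\<forall>j\<le>l. forward \<omega> j = w ! (k + j)) \<and> (\<forall>j\<le>k. backward \<omega> j = w ! (k - j))"
    unfolding subword_eq_iff
  proof safe
    fix j assume H: "\<forall>i<length w. trajectory \<omega> (- int k + int i) = w ! i"
    { assume "j \<le> l"
      then show "forward \<omega> j = w ! (k + j)"
        using H[rule_format, of "k + j"] w by simp }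
    { assume j: "j \<le> k"
      have "- int k + int (k - j) = - int j"
        using j by simp
      then show "backward \<omega> j = w ! (k - j)"
        using H[rule_format, of "k - j"] w by simp }
  next
    fix i assume H: "\<forall>j\<le>l. forward \<omega> j = w ! (k + j)" "\<forall>j\<le>k. backward \<omega> j = w ! (k - j)"
      and i: "i < length w"
    show "trajectory \<omega> (- int k + int i) = w ! i"
    proof (cases "i \<ge> k")
      case True
      then have "- int k + int i = int (i - k)"
        by simp
      then have "trajectory \<omega> (- int k + int i) = forward \<omega> (i - k)"
        by (simp only: trajectory_int)
      then show ?thesis
        using H(1)[rule_format, of "i - k"] True i w by simp
    next
      case False
      then have "- int k + int i = - int (k - i)"
        by simp
      then have "trajectory \<omega> (- int k + int i) = backward \<omega> (k - i)"
        by (simp only: trajectory_neg_int)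
      then show ?thesis
        using H(2)[rule_format, of "k - i"] False by simp
    qed
  qed
  also have "\<dots> \<longleftrightarrow> (\<forall>c\<in>window_index w k l. \<omega> c = window_value w k c)"
    unfolding fw bw
    by (auto simp: window_index_def window_value_def ball_Un nat_add_distrib)
  finally show ?thesis .
qed

lemma window_value_mem:
  assumes "length w = k + l + 1" "set w \<subseteq> S" "c \<in> window_index w k l"
  shows "window_value w k c \<in> S"
proof -
  have "w ! i \<in> S" if "i \<le> k + l" for i
    using that assms(1,2) by (simp add: subset_iff)
  then show ?thesis
    using assms(3) by (auto simp: window_index_def window_value_def)
qed

text \<open>The backward factors \<open>p t * P t s / p s\<close> telescope: they move the initial
  weight from the state at time \<open>0\<close> to the first state of the word.\<close>

lemma prod_window:
  assumes w: "length w = k + l + 1" "set w \<subseteq> S"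
  shows "(\<Prod>c\<in>window_index w k l. choice_prob c (window_value w k c)) = word_weight w"
proof -
  have S: "w ! i \<in> S" if "i \<le> k + l" for i
    using that w by (simp add: subset_iff)
  let ?f = "\<lambda>c. choice_prob c (window_value w k c)"
  let ?A = "(\<lambda>j. Some (int j, w ! (k + j))) ` {..<l}" and ?B = "(\<lambda>j. Some (- 1 - int j, w ! (k - j))) ` {..<k}"
  have "?A \<inter> ?B = {}"
    by auto
  then have "prod ?f (window_index w k l) = ?f None * (prod ?f ?A * prod ?f ?B)"
    unfolding window_index_def by (subst prod.insert) (auto simp: prod.union_disjoint)
  also have "?f None = p (w ! k)"
    by (simp add: choice_prob_def window_value_def)
  also have "prod ?f ?A = (\<Prod>j<l. P (w ! (k + j)) (w ! Suc (k + j)))"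
    by (subst prod.reindex) (auto simp: inj_on_def choice_prob_def window_value_def S intro!: prod.cong)
  also have "prod ?f ?B = (\<Prod>j<k. p (w ! (k - Suc j)) * P (w ! (k - Suc j)) (w ! (k - j)) / p (w ! (k - j)))"
    by (subst prod.reindex) (auto simp: inj_on_def choice_prob_def window_value_def S nat_add_distrib intro!: prod.cong)
  also have "p (w ! k) * ((\<Prod>j<l. P (w ! (k + j)) (w ! Suc (k + j))) *
      (\<Prod>j<k. p (w ! (k - Suc j)) * P (w ! (k - Suc j)) (w ! (k - j)) / p (w ! (k - j)))) =
      p (w ! 0) * (\<Prod>i<k + l. P (w ! i) (w ! Suc i))"
  proof -
    have "p (w ! k) * (\<Prod>j<m. p (w ! (k - Suc j)) * P (w ! (k - Suc j)) (w ! (k - j)) / p (w ! (k - j))) =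
        p (w ! (k - m)) * (\<Prod>j<m. P (w ! (k - Suc j)) (w ! (k - j)))" if "m \<le> k" for m
      using that
    proof (induction m)
      case (Suc m)
      have "0 < p (w ! (k - m))"
        by (intro p_pos S) simp
      then show ?case
        using Suc by (simp add: field_simps)
    qed simp
    from this[of k] have "p (w ! k) * (\<Prod>j<k. p (w ! (k - Suc j)) * P (w ! (k - Suc j)) (w ! (k - j)) / p (w ! (k - j))) =
        p (w ! 0) * (\<Prod>j<k. P (w ! (k - Suc j)) (w ! Suc (k - Suc j)))"
      by (simp add: Suc_diff_Suc)
    also have "(\<Prod>j<k. P (w ! (k - Suc j)) (w ! Suc (k - Suc j))) = (\<Prod>i<k. P (w ! i) (w ! Suc i))"
      by (rule prod.nat_diff_reindex)
    finally have *: "p (w ! k) * (\<Prod>j<k. p (w ! (k - Suc j)) * P (w ! (k - Suc j)) (w ! (k - j)) / p (w ! (k - j))) =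
        p (w ! 0) * (\<Prod>i<k. P (w ! i) (w ! Suc i))" .
    have "(\<Prod>i<k + m. P (w ! i) (w ! Suc i)) =
        (\<Prod>i<k. P (w ! i) (w ! Suc i)) * (\<Prod>j<m. P (w ! (k + j)) (w ! Suc (k + j)))" for m
      by (induction m) auto
    then show ?thesis
      using * by (simp add: mult_ac)
  qed
  also have "\<dots> = word_weight w"
    using w(1) hd_conv_nth[of w] by (cases w) (auto simp: word_weight_def)
  finally show ?thesis .
qed

lemma edge_shift_full: "edge_shift edges \<subseteq> full_shift S"
  using edges_subset by (force simp: edge_shift_def full_shift_def)

lemma trajectory_cylinder:
  assumes w: "length w = k + l + 1" "set w \<subseteq> S"
  defines "V \<equiv> trajectory -` cylinder (edge_shift edges) w (- int k) \<inter> space choice_space"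
  shows "V \<in> sets choice_space" and "emeasure choice_space V = ennreal (word_weight w)"
proof -
  define C where "C c = {window_value w k c} \<inter> choices c" for c
  have fin: "finite (window_index w k l)"
    by (simp add: window_index_def)
  have C: "C c \<in> sets (choice_measure c)" for c
    by (auto simp: C_def choice_measure_def sets_point_measure)
  have V: "V = {\<omega> \<in> space choice_space. \<forall>c\<in>window_index w k l. \<omega> c \<in> C c}"
    using trajectory_in_edge_shift choice_mem trajectory_window[OF w(1)]
    by (auto simp: V_def cylinder_def C_def)
  show "V \<in> sets choice_space"
    unfolding V using fin C by (intro sets.sets_Collect_finite_All sets_Collect_single') auto
  have "emeasure choice_space V = (\<Prod>c\<in>window_index w k l. emeasure (choice_measure c) (C c))"
    unfolding V using fin C by (intro choice.emeasure_PiM_Collect) auto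
  also have "\<dots> = (\<Prod>c\<in>window_index w k l. ennreal (choice_prob c (window_value w k c)))"
    unfolding C_def using window_value_mem[OF w] by (intro prod.cong refl emeasure_choice)
  also have "\<dots> = ennreal (word_weight w)"
    using window_value_mem[OF w] choice_prob_nonneg
    by (subst prod_ennreal) (auto simp: prod_window[OF w])
  finally show "emeasure choice_space V = ennreal (word_weight w)" .
qed

section \<open>The law of the trajectory as a Markov measure\<close>

definition law :: "'s point measure" where
  "law = distr choice_space (borel_shift (edge_shift edges)) trajectory"

lemma trajectory_measurable: "trajectory \<in> measurable choice_space (borel_shift (edge_shift edges))"
proof (rule measurable_sigma_sets[OF sets_borel_shift_cylinders[OF finite_states edge_shift_full]])
  show "centered_cylinders S (edge_shift edges) \<subseteq> Pow (edge_shift edges)"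
    by (auto simp: centered_cylinders_def cylinder_def)
  show "trajectory \<in> space choice_space \<rightarrow> edge_shift edges"
    using trajectory_in_edge_shift by blast
  fix V assume "V \<in> centered_cylinders S (edge_shift edges)"
  then show "trajectory -` V \<inter> space choice_space \<in> sets choice_space"
    using trajectory_cylinder(1) by (fastforce simp: centered_cylinders_def)
qed

lemma sets_law: "sets law = sets (borel_shift (edge_shift edges))"
  and space_law: "space law = edge_shift edges"
  by (simp_all add: law_def)

lemma prob_space_law: "prob_space law"
  unfolding law_def by (rule choice.P.prob_space_distr[OF trajectory_measurable])

lemma emeasure_law_cylinder:
  assumes "length w = k + l + 1" "set w \<subseteq> S"
  shows "emeasure law (cylinder (edge_shift edges) w (- int k)) = ennreal (word_weight w)"
  unfolding law_def using trajectory_cylinder(2)[OF assms]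
  by (subst emeasure_distr[OF trajectory_measurable cylinder_in_sets])

lemma word_weight_nonneg: "set w \<subseteq> S \<Longrightarrow> w \<noteq> [] \<Longrightarrow> 0 \<le> word_weight w"
  unfolding word_weight_def using P_nonneg p_nonneg
  by (intro mult_nonneg_nonneg prod_nonneg) (auto simp: subset_iff)

lemma measure_law_cylinder:
  assumes "w \<noteq> []" "set w \<subseteq> S"
  shows "measure law (cylinder (edge_shift edges) w 0) = word_weight w"
  using emeasure_law_cylinder[of w 0 "length w - 1"] assms word_weight_nonneg[OF assms(2,1)]
  by (simp add: measure_def)

lemma shift_map_edge_shift: "shift_map ` edge_shift E = edge_shift E"
proof
  show "shift_map ` edge_shift E \<subseteq> edge_shift E"
    by (auto simp: shift_map_def edge_shift_def)
  show "edge_shift E \<subseteq> shift_map ` edge_shift E"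
  proof
    fix x assume x: "x \<in> edge_shift E"
    show "x \<in> shift_map ` edge_shift E"
      using edge_shift_translate[OF x, of "- 1"]
      by (intro image_eqI[of _ _ "\<lambda>j. x (j + - 1)"]) (auto simp: shift_map_def)
  qed
qed

text \<open>The weight of a word does not depend on where its window lies around time
  \<open>0\<close>, and centered cylinders are closed under intersections and generate the Borel
  sets.\<close>

lemma invariant_law: "invariant_measure (edge_shift edges) law"
proof -
  let ?Z = "edge_shift edges"
  interpret prob_space law
    by (rule prob_space_law)
  have meas: "shift_map \<in> measurable law law"
    using measurable_borel_shift[OF continuous_map_shift_map[of ?Z]]
    by (simp add: shift_map_edge_shift sets_law cong: measurable_cong_sets)
  have "distr law law shift_map = law"
  proof (rule measure_eqI_generator_eq_countable)
    show "Int_stable (centered_cylinders S ?Z)"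
      by (rule Int_stable_centered_cylinders)
    show "centered_cylinders S ?Z \<subseteq> Pow ?Z"
      by (auto simp: centered_cylinders_def cylinder_def)
    show "sets law = sigma_sets ?Z (centered_cylinders S ?Z)"
      unfolding sets_law by (rule sets_borel_shift_cylinders[OF finite_states edge_shift_full])
    then show "sets (distr law law shift_map) = sigma_sets ?Z (centered_cylinders S ?Z)"
      by simp
    show "\<Union> (centered_cylinders S ?Z) = ?Z"
      by (rule Union_centered_cylinders[OF edge_shift_full])
    show "countable (centered_cylinders S ?Z)"
      by (rule countable_centered_cylinders[OF finite_states])
    show "emeasure (distr law law shift_map) V \<noteq> \<infinity>" for V
      using prob_space.emeasure_le_1[OF prob_space_distr[OF meas], of V]
      by (auto simp: top_unique)
    fix V assume V: "V \<in> centered_cylinders S ?Z"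
    then have sets: "V \<in> sets law"
      unfolding sets_law by (auto simp: centered_cylinders_def cylinder_in_sets)
    show "emeasure (distr law law shift_map) V = emeasure law V"
    proof (cases "V = {}")
      case False
      then obtain w k where w: "V = cylinder ?Z w (- int k)" "set w \<subseteq> S" "length w = 2 * k + 1" "k > 0"
        using V by (auto simp: centered_cylinders_def)
      have "shift_map -` V \<inter> space law = cylinder ?Z w (- int (k - 1))"
        using w(4) shift_map_edge_shift[of edges] unfolding w(1) space_law
        by (auto simp: cylinder_def subword_eq_iff shift_map_def of_nat_diff algebra_simps)
      then have "emeasure (distr law law shift_map) V = emeasure law (cylinder ?Z w (- int (k - 1)))"
        using meas sets by (simp add: emeasure_distr)
      also have "\<dots> = ennreal (word_weight w)"
        using w by (intro emeasure_law_cylinder[of _ _ "k + 1"]) auto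
      also have "\<dots> = emeasure law V"
        unfolding w(1) using w by (intro emeasure_law_cylinder[of _ _ k, symmetric]) auto
      finally show ?thesis .
    qed simp
  qed simp
  then have "emeasure law (shift_map -` V \<inter> ?Z) = emeasure law V" if "V \<in> sets law" for V
    using emeasure_distr[OF meas that] space_law by simp
  then show ?thesis
    unfolding invariant_measure_def using prob_space_law sets_law space_law by auto
qed

text \<open>A nonempty cylinder contains a centered one around each of its points, and all
  transition factors along a path are positive.\<close>

lemma fully_supported_law: "fully_supported (edge_shift edges) law"
  unfolding fully_supported_def
proof (intro allI impI)
  fix w i assume "cylinder (edge_shift edges) w i \<noteq> {}"
  then obtain x where x: "x \<in> edge_shift edges" "subword x i (length w) = w"
    by (auto simp: cylinder_def)
  interpret prob_space law
    by (rule prob_space_law)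
  define k where "k = Suc (nat \<bar>i\<bar> + length w)"
  have k: "k > 0"
    by (simp add: k_def)
  define v where "v = subword x (- int k) (2 * k + 1)"
  have "cylinder (edge_shift edges) v (- int k) \<subseteq> cylinder (edge_shift edges) w i"
  proof
    fix z assume "z \<in> cylinder (edge_shift edges) v (- int k)"
    then have z: "z \<in> edge_shift edges" "\<And>j. \<bar>j\<bar> \<le> int k \<Longrightarrow> z j = x j"
      unfolding v_def centered_cylinder_of_point(2)[OF x(1) edge_shift_full k] by blast+
    have "z (i + int m) = x (i + int m)" if "m < length w" for m
      using that by (intro z(2)) (auto simp: k_def)
    then show "z \<in> cylinder (edge_shift edges) w i"
      using x z(1) by (auto simp: cylinder_def subword_eq_iff)
  qed
  moreover have "0 < measure law (cylinder (edge_shift edges) v (- int k))"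
  proof -
    have vS: "set v \<subseteq> S"
      using x(1) edge_shift_full by (auto simp: v_def subword_def full_shift_def)
    have "0 < word_weight v"
      unfolding word_weight_def
    proof (intro mult_pos_pos prod_pos)
      show "0 < p (hd v)"
        using vS hd_in_set[of v] by (intro p_pos) (auto simp: v_def subword_def)
      fix j assume "j \<in> {..<length v - 1}"
      then show "0 < P (v ! j) (v ! Suc j)"
        using edge_shift_step[OF x(1), of "- int k" j] by (simp add: v_def edges_def)
    qed
    then show ?thesis
      using emeasure_law_cylinder[of v k k] vS by (simp add: measure_def v_def)
  qed
  ultimately show "0 < measure law (cylinder (edge_shift edges) w i)"
    using finite_measure_mono[of "cylinder (edge_shift edges) v (- int k)" "cylinder (edge_shift edges) w i"]
      cylinder_in_sets[of "edge_shift edges" w i] by (simp add: sets_law)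
qed

lemma shift_of_finite_type_edges: "shift_of_finite_type S (edge_shift edges)"
  unfolding shift_of_finite_type_def
proof (intro conjI exI)
  let ?F = "{[s, t] | s t. s \<in> S \<and> t \<in> S \<and> (s, t) \<notin> edges}"
  show "finite S"
    by (rule finite_states)
  have "?F \<subseteq> (\<lambda>(s, t). [s, t]) ` (S \<times> S)"
    by auto
  then show "finite ?F"
    using finite_states finite_subset by fastforce
  have pair: "subword x i n = [s, t] \<longleftrightarrow> n = 2 \<and> x i = s \<and> x (i + 1) = t" for x :: "'s point" and i n s t
    by (auto simp: list_eq_iff_nth_eq less_2_cases_iff nth_Cons' dest: spec[of _ 0] spec[of _ 1])
  show "edge_shift edges = {x \<in> full_shift S. \<forall>i n. subword x i n \<notin> ?F}"
  proof (intro equalityI subsetI)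
    fix x assume "x \<in> edge_shift edges"
    then show "x \<in> {x \<in> full_shift S. \<forall>i n. subword x i n \<notin> ?F}"
      using edge_shift_full by (auto simp: edge_shift_def pair)
  next
    fix x assume x: "x \<in> {x \<in> full_shift S. \<forall>i n. subword x i n \<notin> ?F}"
    have "(x i, x (i + 1)) \<in> edges" for i
    proof (rule ccontr)
      assume "(x i, x (i + 1)) \<notin> edges"
      moreover have "x i \<in> S" "x (i + 1) \<in> S"
        using x by (auto simp: full_shift_def)
      ultimately have "subword x i 2 \<in> ?F"
        using pair by blast
      then show False
        using x by blast
    qed
    then show "x \<in> edge_shift edges"
      by (simp add: edge_shift_def)
  qed
qed

lemma one_step_markov_law: "one_step_markov_measure S (edge_shift edges) law"
  unfolding one_step_markov_measure_def
proof (intro conjI exI ballI impI)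
  show "probability_vector S p" "stochastic_matrix S P"
    using p_nonneg p_sum P_nonneg P_row by (auto simp: probability_vector_def stochastic_matrix_def)
  fix w assume w: "w \<in> lang (edge_shift edges)" "w \<noteq> []"
  then have "set w \<subseteq> S"
    using edge_shift_full by (fastforce simp: lang_def subword_def full_shift_def)
  then show "measure law (cylinder (edge_shift edges) w 0) =
      p (hd w) * (\<Prod>i<length w - 1. P (w ! i) (w ! Suc i))"
    using measure_law_cylinder w(2) by (simp add: word_weight_def)
qed (rule shift_of_finite_type_edges invariant_law)+

end

section \<open>Chains that drift towards a loop\<close>

lemma nth_concat_replicate:
  "i < m * length u \<Longrightarrow> concat (replicate m u) ! i = u ! (i mod length u)"
proof (induction m arbitrary: i)
  case (Suc m)
  then show ?case
    by (cases "i < length u") (auto simp: nth_append mod_if[of i])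
qed simp

lemma length_concat_replicate: "length (concat (replicate m u)) = m * length u"
  by (induction m) auto

text \<open>States carry labels \<open>g\<close>; the word \<open>u\<close> is read off along the \<open>nx\<close>-orbit of \<open>b\<close>, which \<open>nx\<close>
  reaches from every state within \<open>D\<close> steps.\<close>

locale drifting_chain = markov_chain S P p
  for S :: "'s set" and P p +
  fixes g :: "'s \<Rightarrow> 'b" and u :: "'b list" and b :: 's and nx :: "'s \<Rightarrow> 's" and D :: nat
    and \<eta> \<kappa> :: real
  assumes u_ne: "u \<noteq> []"
    and aperiodic: "(\<And>j. j < length u \<Longrightarrow> u ! ((i + j) mod length u) = u ! j) \<Longrightarrow> length u dvd i"
    and b: "b \<in> S"
    and nx: "s \<in> S \<Longrightarrow> nx s \<in> S"
    and loop: "(nx ^^ length u) b = b"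
    and loop_label: "j < length u \<Longrightarrow> g ((nx ^^ j) b) = u ! j"
    and attract: "s \<in> S \<Longrightarrow> \<exists>i\<le>D. (nx ^^ i) s = b"
    and light: "t \<noteq> nx s \<Longrightarrow> P s t \<le> \<eta>"
    and heavy: "s \<in> S \<Longrightarrow> \<kappa> \<le> P s (nx s)"
    and \<eta>: "0 \<le> \<eta>" and \<kappa>: "0 < \<kappa>"
begin

abbreviation u_power :: "nat \<Rightarrow> 'b list" where
  "u_power m \<equiv> concat (replicate m u)"

definition lifts :: "'b list \<Rightarrow> 's list set" where
  "lifts w = {s. set s \<subseteq> S \<and> map g s = w}"

definition image_weight :: "'b list \<Rightarrow> real" where
  "image_weight w = (\<Sum>s\<in>lifts w. word_weight s)"

definition path_weight :: "'s list \<Rightarrow> real" where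
  "path_weight s = (\<Prod>i<length s - 1. P (s ! i) (s ! Suc i))"

text \<open>Only visits to \<open>b\<close> at the start of a copy of \<open>u\<close> are excluded,
  since these are the ones that cut the word between whole copies of \<open>u\<close>.\<close>

definition avoiding :: "nat \<Rightarrow> 's list set" where
  "avoiding m = {s \<in> lifts (u_power m). \<forall>i<m. s ! (i * length u) \<noteq> b}"

lemma length_lifts: "s \<in> lifts w \<Longrightarrow> length s = length w"
  by (auto simp: lifts_def)

lemma lifts_subset: "lifts w \<subseteq> {s. set s \<subseteq> S \<and> length s = length w}"
  by (auto simp: lifts_def)

lemma finite_lifts: "finite (lifts w)"
  by (rule finite_subset[OF lifts_subset finite_lists_length_eq[OF finite_states]])

section \<open>Weights of words, of images and of avoiding lifts\<close>

lemma P_le_1: "P s t \<le> 1"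
proof (cases "s \<in> S \<and> t \<in> S")
  case True
  then have "P s t \<le> (\<Sum>t\<in>S. P s t)"
    using finite_states P_nonneg by (intro member_le_sum) auto
  then show ?thesis
    using P_row True by simp
qed (use P_outside in force)

lemma p_le_1: "s \<in> S \<Longrightarrow> p s \<le> 1"
  using member_le_sum[of s S p] p_nonneg finite_states p_sum by auto

lemma path_weight_nonneg: "0 \<le> path_weight s"
  unfolding path_weight_def by (intro prod_nonneg) (simp add: P_nonneg)

lemma path_weight_le_1: "path_weight s \<le> 1"
  unfolding path_weight_def by (intro prod_le_1) (simp add: P_nonneg P_le_1)

lemma path_weight_append:
  assumes "s \<noteq> []" "t \<noteq> []"
  shows "path_weight (s @ t) = path_weight s * P (last s) (hd t) * path_weight t"
proof -
  obtain k l where k: "length s = Suc k" and l: "length t = Suc l"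
    using assms by (metis length_0_conv not0_implies_Suc)
  have "path_weight (s @ t) = (\<Prod>i<k + Suc l. P ((s @ t) ! i) ((s @ t) ! Suc i))"
    by (simp add: path_weight_def k l)
  also have "\<dots> = (\<Prod>i<k. P ((s @ t) ! i) ((s @ t) ! Suc i)) *
      (\<Prod>i<Suc l. P ((s @ t) ! (k + i)) ((s @ t) ! Suc (k + i)))"
    by (induction l) auto
  also have "(\<Prod>i<Suc l. P ((s @ t) ! (k + i)) ((s @ t) ! Suc (k + i))) =
      P (s ! k) (t ! 0) * (\<Prod>i<l. P (t ! i) (t ! Suc i))"
    by (subst prod.lessThan_Suc_shift) (simp add: nth_append k)
  also have "(\<Prod>i<k. P ((s @ t) ! i) ((s @ t) ! Suc i)) = (\<Prod>i<k. P (s ! i) (s ! Suc i))"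
    by (intro prod.cong) (auto simp: nth_append k)
  finally show ?thesis
    using assms by (simp add: path_weight_def k l last_conv_nth hd_conv_nth)
qed

lemma path_weight_append_le: "path_weight (s @ t) \<le> path_weight s * path_weight t"
proof (cases "s = [] \<or> t = []")
  case False
  have "path_weight s * P (last s) (hd t) * path_weight t \<le> path_weight s * 1 * path_weight t"
    by (intro mult_right_mono mult_left_mono P_le_1 path_weight_nonneg)
  then show ?thesis
    using False path_weight_append[of s t] by simp
qed (auto simp: path_weight_def)

text \<open>Joining replaces the initial weight of \<open>t\<close> by a transition probability,
  which is at most \<open>1\<close>; hence the factor \<open>C\<close>, a bound for
  \<open>1 / p\<close>.\<close>

lemma word_weight_append_le:
  assumes C: "\<And>s. s \<in> S \<Longrightarrow> 1 \<le> C * p s" and s: "s \<noteq> []" "set s \<subseteq> S" and t: "t \<noteq> []" "set t \<subseteq> S"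
  shows "word_weight (s @ t) \<le> C * (word_weight s * word_weight t)"
proof -
  have "hd s \<in> S" "hd t \<in> S"
    using s t by auto
  have "word_weight (s @ t) = p (hd s) * path_weight (s @ t)"
    using s by (simp add: word_weight_def path_weight_def)
  also have "\<dots> \<le> p (hd s) * (path_weight s * path_weight t) * 1"
    using path_weight_append_le p_nonneg[OF \<open>hd s \<in> S\<close>] by (simp add: mult_left_mono)
  also have "\<dots> \<le> p (hd s) * (path_weight s * path_weight t) * (C * p (hd t))"
    using C[OF \<open>hd t \<in> S\<close>] p_nonneg[OF \<open>hd s \<in> S\<close>] path_weight_nonneg by (intro mult_left_mono) auto
  also have "\<dots> = C * (word_weight s * word_weight t)"
    by (simp add: word_weight_def path_weight_def)
  finally show ?thesis .
qed

lemma lifts_append: "lifts (v @ w) = (\<lambda>(s, t). s @ t) ` (lifts v \<times> lifts w)"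
proof (intro equalityI subsetI)
  fix x assume x: "x \<in> lifts (v @ w)"
  then have "map g x = v @ w" "set x \<subseteq> S"
    by (auto simp: lifts_def)
  then obtain s t where "x = s @ t" "map g s = v" "map g t = w"
    by (auto simp: map_eq_append_conv)
  then show "x \<in> (\<lambda>(s, t). s @ t) ` (lifts v \<times> lifts w)"
    using \<open>set x \<subseteq> S\<close> by (auto simp: lifts_def)
qed (auto simp: lifts_def)

lemma inj_on_append_lifts: "inj_on (\<lambda>(s, t). s @ t) (lifts v \<times> T)"
  by (auto simp: inj_on_def dest!: length_lifts)

lemma sum_lifts_append: "(\<Sum>x\<in>lifts (v @ w). f x) = (\<Sum>s\<in>lifts v. \<Sum>t\<in>lifts w. f (s @ t))"
  unfolding lifts_append sum.reindex[OF inj_on_append_lifts]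
  by (simp add: sum.cartesian_product case_prod_unfold)

lemma lifts_weight_nonneg: "s \<in> lifts w \<Longrightarrow> w \<noteq> [] \<Longrightarrow> 0 \<le> word_weight s"
  by (rule word_weight_nonneg) (auto simp: lifts_def)

text \<open>Following \<open>nx\<close> throughout a long enough stretch labelled by powers of \<open>u\<close> leads to \<open>b\<close>, and
  by aperiodicity of \<open>u\<close> this happens at the beginning of a copy of \<open>u\<close>.\<close>

lemma avoiding_light_step:
  assumes s: "s \<in> avoiding (Suc D)"
  shows "\<exists>i<length s - 1. s ! Suc i \<noteq> nx (s ! i)"
proof (rule ccontr)
  let ?n = "length u"
  assume "\<not> ?thesis"
  then have step: "s ! Suc i = nx (s ! i)" if "Suc i < length s" for i
    using that by auto
  have len: "length s = Suc D * ?n"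
    using s length_lifts by (fastforce simp: avoiding_def length_concat_replicate)
  have n: "?n > 0"
    using u_ne by simp
  have "s ! 0 \<in> S"
    using s len n by (auto simp: avoiding_def lifts_def subset_iff)
  have iter: "s ! i = (nx ^^ i) (s ! 0)" if "i < length s" for i
    using that by (induction i) (auto simp: step)
  obtain i where i: "i \<le> D" "(nx ^^ i) (s ! 0) = b"
    using attract[OF \<open>s ! 0 \<in> S\<close>] by blast
  have "D * 1 \<le> D * ?n"
    using n by (intro mult_le_mono2) linarith
  then have iD: "i + j < length s" if "j < ?n" for j
    using i(1) len that unfolding mult_Suc by linarith
  have "u ! ((i + j) mod ?n) = u ! j" if j: "j < ?n" for j
  proof -
    have "map g s = u_power (Suc D)"
      using s by (simp add: avoiding_def lifts_def)
    then have "g (s ! (i + j)) = u_power (Suc D) ! (i + j)"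
      using iD[OF j] by (metis nth_map)
    also have "\<dots> = u ! ((i + j) mod ?n)"
      using iD[OF j] len by (intro nth_concat_replicate) simp
    finally have "g ((nx ^^ j) b) = u ! ((i + j) mod ?n)"
      using iter[OF iD[OF j]] i(2) by (simp add: funpow_add add.commute[of i])
    then show ?thesis
      using loop_label[OF j] by simp
  qed
  then have "?n dvd i"
    by (rule aperiodic)
  then obtain c where c: "i = c * ?n"
    by (metis dvd_def mult.commute)
  have "c * 1 \<le> c * ?n"
    using n by (intro mult_le_mono2) linarith
  then have "c < Suc D"
    using i(1) c by linarith
  moreover have "s ! (c * ?n) = b"
    using iter[of i] iD[of 0] i(2) n c by simp
  ultimately show False
    using s by (auto simp: avoiding_def)
qed

text \<open>Each stretch of \<open>Suc D\<close> copies of \<open>u\<close> contains a light step,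
  and all other factors are at most \<open>1\<close>.\<close>

lemma avoiding_path_weight: "s \<in> avoiding (q * Suc D) \<Longrightarrow> path_weight s \<le> \<eta> ^ q"
proof (induction q arbitrary: s)
  case 0
  then show ?case
    by (simp add: path_weight_le_1)
next
  case (Suc q)
  let ?n = "length u"
  have "u_power (Suc q * Suc D) = u_power (Suc D) @ u_power (q * Suc D)"
    by (simp only: mult_Suc replicate_add concat_append)
  then have "s \<in> lifts (u_power (Suc D) @ u_power (q * Suc D))"
    using Suc.prems by (simp add: avoiding_def)
  then obtain s1 s2 where s: "s = s1 @ s2" "s1 \<in> lifts (u_power (Suc D))" "s2 \<in> lifts (u_power (q * Suc D))"
    unfolding lifts_append by auto
  have l1: "length s1 = Suc D * ?n"
    using length_lifts[OF s(2)] by (simp only: length_concat_replicate)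
  have avoid: "s ! (i * ?n) \<noteq> b" if "i < Suc q * Suc D" for i
    using Suc.prems that by (auto simp: avoiding_def)
  have "s1 ! (i * ?n) \<noteq> b" if "i < Suc D" for i
  proof -
    have "i * ?n < Suc D * ?n"
      using that u_ne by (intro mult_strict_right_mono) auto
    then show ?thesis
      using avoid[of i] that by (simp add: s(1) nth_append l1)
  qed
  then have s1: "s1 \<in> avoiding (Suc D)"
    using s(2) by (simp add: avoiding_def)
  have "s2 ! (i * ?n) \<noteq> b" if "i < q * Suc D" for i
  proof -
    have "(Suc D + i) * ?n = length s1 + i * ?n"
      by (simp only: l1 add_mult_distrib)
    then have "s ! ((Suc D + i) * ?n) = s2 ! (i * ?n)"
      by (simp only: s(1) nth_append_length_plus)
    then show ?thesis
      using avoid[of "Suc D + i"] that by simp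
  qed
  then have s2: "s2 \<in> avoiding (q * Suc D)"
    using s(3) by (simp add: avoiding_def)
  obtain i where i: "i < length s1 - 1" "s1 ! Suc i \<noteq> nx (s1 ! i)"
    using avoiding_light_step[OF s1] by blast
  have "path_weight s1 = P (s1 ! i) (s1 ! Suc i) * (\<Prod>j\<in>{..<length s1 - 1} - {i}. P (s1 ! j) (s1 ! Suc j))"
    unfolding path_weight_def using i(1) by (intro prod.remove) auto
  also have "\<dots> \<le> \<eta> * 1"
    using light[OF i(2)] \<eta> by (intro mult_mono prod_le_1 prod_nonneg) (auto simp: P_nonneg P_le_1)
  finally have "path_weight s1 * path_weight s2 \<le> \<eta> * \<eta> ^ q"
    using Suc.IH[OF s2] \<eta> path_weight_nonneg by (intro mult_mono) auto
  then show ?case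
    using path_weight_append_le[of s1 s2] s(1) by simp
qed

text \<open>A crude count of all words over \<open>S\<close> suffices: their number and the bound
  for each weight are both \<open>q\<close>-th powers, so a small \<eta> outweighs the
  growth.\<close>

lemma sum_avoiding_le:
  assumes "q > 0"
  shows "(\<Sum>s\<in>avoiding (q * Suc D). word_weight s) \<le> (real (card S) ^ (Suc D * length u) * \<eta>) ^ q"
proof -
  let ?A = "avoiding (q * Suc D)" and ?l = "q * (Suc D * length u)"
  have sub: "?A \<subseteq> {s. set s \<subseteq> S \<and> length s = ?l}"
  proof
    fix s assume "s \<in> ?A"
    then have "s \<in> lifts (u_power (q * Suc D))"
      by (simp only: avoiding_def mem_Collect_eq)
    then show "s \<in> {s. set s \<subseteq> S \<and> length s = ?l}"
      using length_lifts[of s "u_power (q * Suc D)"]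
      by (simp only: length_concat_replicate mult.assoc) (simp add: lifts_def)
  qed
  then have "card ?A \<le> card {s. set s \<subseteq> S \<and> length s = ?l}"
    by (intro card_mono finite_lists_length_eq finite_states)
  also have "\<dots> = card S ^ ?l"
    by (rule card_lists_length_eq[OF finite_states])
  finally have card: "real (card ?A) \<le> real (card S) ^ ?l"
    by (metis of_nat_le_iff of_nat_power)
  have "(\<Sum>s\<in>?A. word_weight s) \<le> (\<Sum>s\<in>?A. \<eta> ^ q)"
  proof (rule sum_mono)
    fix s assume s: "s \<in> ?A"
    have "?l > 0"
      using assms u_ne by simp
    then have "hd s \<in> S"
      using s sub by (metis (mono_tags, lifting) hd_in_set length_greater_0_conv mem_Collect_eq subset_iff)
    then have "word_weight s \<le> 1 * path_weight s"
      unfolding word_weight_def path_weight_def[symmetric]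
      by (intro mult_right_mono p_le_1 path_weight_nonneg)
    then show "word_weight s \<le> \<eta> ^ q"
      using avoiding_path_weight[OF s] by simp
  qed
  also have "\<dots> = real (card ?A) * \<eta> ^ q"
    by simp
  also have "\<dots> \<le> real (card S) ^ ?l * \<eta> ^ q"
    using card \<eta> by (intro mult_right_mono) auto
  also have "\<dots> = (real (card S) ^ (Suc D * length u) * \<eta>) ^ q"
    by (simp only: power_mult_distrib power_mult[symmetric] mult.commute[of q])
  finally show ?thesis .
qed

text \<open>The loop itself is one lift, and each of its steps has probability at least
  \<kappa>.\<close>

lemma image_weight_power_ge:
  assumes "m > 0"
  shows "p b * \<kappa> ^ (m * length u) \<le> image_weight (u_power m)"
proof -
  let ?l = "m * length u"
  define s where "s = map (\<lambda>i. (nx ^^ i) b) [0..<?l]"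
  have l: "?l > 0"
    using assms u_ne by simp
  have S: "(nx ^^ i) b \<in> S" for i
    by (induction i) (auto simp: b nx)
  have "g ((nx ^^ i) b) = u_power m ! i" if "i < ?l" for i
  proof -
    have "(nx ^^ i) b = (nx ^^ (i mod length u)) b"
      by (rule funpow_mod_eq[OF loop, symmetric])
    then show ?thesis
      using that u_ne by (simp add: nth_concat_replicate loop_label)
  qed
  then have s: "s \<in> lifts (u_power m)"
    using S by (auto simp: lifts_def s_def length_concat_replicate intro!: nth_equalityI)
  \<comment> \<open>There is one step less than there are letters; the additional factor is harmless
    because \<kappa> is at most \<open>P b (nx b)\<close>, hence at most \<open>1\<close>.\<close>
  have "\<kappa> ^ ?l \<le> \<kappa> ^ (?l - 1)"
    using \<kappa> heavy[OF b] P_le_1[of b "nx b"] by (intro power_decreasing) auto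
  also have "\<dots> = (\<Prod>i<?l - 1. \<kappa>)"
    by simp
  also have "\<dots> \<le> (\<Prod>i<?l - 1. P (s ! i) (s ! Suc i))"
    using \<kappa> heavy[OF S] by (intro prod_mono) (auto simp: s_def less_imp_le)
  finally have "p b * \<kappa> ^ ?l \<le> word_weight s"
    using l p_nonneg[OF b] by (simp add: word_weight_def s_def hd_map hd_conv_nth mult_left_mono)
  also have "\<dots> \<le> image_weight (u_power m)"
    unfolding image_weight_def using s l
    by (intro member_le_sum finite_lifts) (auto intro!: lifts_weight_nonneg simp: length_concat_replicate simp flip: length_greater_0_conv)
  finally show ?thesis .
qed

lemma image_weight_nonneg: "w \<noteq> [] \<Longrightarrow> 0 \<le> image_weight w"
  unfolding image_weight_def by (intro sum_nonneg lifts_weight_nonneg)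

text \<open>Cutting at the two joints costs \<open>C^2\<close>, after which the three parts are
  summed independently. The \<open>2\<close> is a union bound over the two blocks that may avoid the
  loop.\<close>

lemma image_weight_sandwich_le:
  assumes C: "\<And>s. s \<in> S \<Longrightarrow> 1 \<le> C * p s" and m: "m > 0" and v: "v \<noteq> []"
    and avoid: "\<And>s t r. s \<in> lifts (u_power m) \<Longrightarrow> t \<in> lifts v \<Longrightarrow> r \<in> lifts (u_power m) \<Longrightarrow>
      word_weight (s @ t @ r) > 0 \<Longrightarrow> s \<in> avoiding m \<or> r \<in> avoiding m"
  shows "image_weight (u_power m @ v @ u_power m) \<le>
    2 * C\<^sup>2 * (\<Sum>s\<in>avoiding m. word_weight s) * image_weight v * image_weight (u_power m)"
proof -
  let ?U = "lifts (u_power m)" and ?V = "lifts v"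
  define a where "a s = (if s \<in> avoiding m then word_weight s else 0)" for s
  have ne: "u_power m \<noteq> []"
    using m u_ne by (cases m) auto
  have C0: "C \<ge> 0"
    using C[OF b] p_pos[OF b] by (smt (verit) mult_nonpos_nonneg)
  have le: "word_weight (s @ t @ r) \<le> C\<^sup>2 * (a s * word_weight t * word_weight r) + C\<^sup>2 * (word_weight s * word_weight t * a r)"
    if s: "s \<in> ?U" and t: "t \<in> ?V" and r: "r \<in> ?U" for s t r
  proof -
    have nn: "0 \<le> word_weight s" "0 \<le> word_weight t" "0 \<le> word_weight r"
      using lifts_weight_nonneg that ne v by blast+
    have a: "0 \<le> a s" "0 \<le> a r"
      using nn by (auto simp: a_def)
    have sets: "s \<noteq> []" "set s \<subseteq> S" "t \<noteq> []" "set t \<subseteq> S" "r \<noteq> []" "set r \<subseteq> S"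
      using that ne v by (auto simp: lifts_def)
    have "word_weight (s @ t @ r) \<le> C * (word_weight s * word_weight (t @ r))"
      using sets by (intro word_weight_append_le[OF C]) auto
    also have "\<dots> \<le> C * (word_weight s * (C * (word_weight t * word_weight r)))"
      using sets nn C0 by (intro mult_left_mono word_weight_append_le[OF C]) auto
    also have "\<dots> = C\<^sup>2 * (word_weight s * word_weight t * word_weight r)"
      by (simp add: power2_eq_square)
    finally have 1: "word_weight (s @ t @ r) \<le> C\<^sup>2 * (word_weight s * word_weight t * word_weight r)" .
    have pos: "0 \<le> C\<^sup>2 * (a s * word_weight t * word_weight r)" "0 \<le> C\<^sup>2 * (word_weight s * word_weight t * a r)"
      using nn a by auto
    consider "s \<in> avoiding m" | "r \<in> avoiding m" | "word_weight (s @ t @ r) \<le> 0"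
      using avoid[OF s t r] by fastforce
    then show ?thesis
      using 1 pos by cases (auto simp: a_def)
  qed
  have suma: "(\<Sum>s\<in>?U. a s) = (\<Sum>s\<in>avoiding m. word_weight s)"
    unfolding a_def using finite_lifts
    by (subst sum.inter_restrict[symmetric]) (auto intro!: sum.cong simp: avoiding_def)
  have "image_weight (u_power m @ v @ u_power m) = (\<Sum>s\<in>?U. \<Sum>t\<in>?V. \<Sum>r\<in>?U. word_weight (s @ t @ r))"
    by (simp add: image_weight_def sum_lifts_append)
  also have "\<dots> \<le> (\<Sum>s\<in>?U. \<Sum>t\<in>?V. \<Sum>r\<in>?U.
      C\<^sup>2 * (a s * word_weight t * word_weight r) + C\<^sup>2 * (word_weight s * word_weight t * a r))"
    by (intro sum_mono le)
  also have "\<dots> = 2 * C\<^sup>2 * (\<Sum>s\<in>avoiding m. word_weight s) * image_weight v * image_weight (u_power m)"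
    by (simp add: sum.distrib suma[symmetric] image_weight_def flip: sum_distrib_left sum_distrib_right)
  finally show ?thesis .
qed

text \<open>Take \<open>m = q * Suc D\<close>. One factor \<open>image_weight (u_power m)\<close>
  and the factor \<open>image_weight v\<close> cancel between the two bounds for the sandwich. The
  remaining factor is at least \<open>p b * (1/2)^q\<close>, but the avoiding weight that must
  dominate it up to constants is at most \<open>(1/4)^q\<close>.\<close>

lemma not_quasi_Bernoulli:
  assumes v: "v \<noteq> []" and pos: "0 < image_weight v"
    and \<eta>': "real (card S) ^ (Suc D * length u) * \<eta> \<le> 1 / 4"
    and \<kappa>': "1 / 2 \<le> \<kappa> ^ (Suc D * length u)"
    and avoid: "\<And>m s t r. s \<in> lifts (u_power m) \<Longrightarrow> t \<in> lifts v \<Longrightarrow> r \<in> lifts (u_power m) \<Longrightarrow>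
      word_weight (s @ t @ r) > 0 \<Longrightarrow> s \<in> avoiding m \<or> r \<in> avoiding m"
    and K: "0 < K" "\<And>m. m > 0 \<Longrightarrow> K * (image_weight (u_power m) * image_weight v * image_weight (u_power m))
      \<le> image_weight (u_power m @ v @ u_power m)"
  shows False
proof -
  \<comment> \<open>The sum bounds every single \<open>1 / p s\<close>.\<close>
  define C where "C = (\<Sum>s\<in>S. 1 / p s)"
  have C: "1 \<le> C * p s" if "s \<in> S" for s
  proof -
    have "1 / p s \<le> C"
      unfolding C_def using that finite_states p_pos by (intro member_le_sum) (auto simp: less_imp_le)
    then show ?thesis
      using p_pos[OF that] by (simp add: field_simps)
  qed
  have bound: "K * p b \<le> 2 * C\<^sup>2 * (1 / 2) ^ q" if q: "q > 0" for q
  proof -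
    let ?m = "q * Suc D"
    let ?a = "\<Sum>s\<in>avoiding ?m. word_weight s"
    have m: "?m > 0"
      using q by simp
    have "p b * (1 / 2) ^ q \<le> p b * (\<kappa> ^ (Suc D * length u)) ^ q"
      using \<kappa>' p_nonneg[OF b] by (intro mult_left_mono power_mono) auto
    also have "\<dots> = p b * \<kappa> ^ (?m * length u)"
      by (simp only: power_mult[symmetric] mult_ac)
    also have "\<dots> \<le> image_weight (u_power ?m)"
      by (rule image_weight_power_ge[OF m])
    finally have lower: "p b * (1 / 2) ^ q \<le> image_weight (u_power ?m)" .
    then have pos': "0 < image_weight (u_power ?m)"
      using p_pos[OF b] by (smt (verit) mult_pos_pos zero_less_power divide_pos_pos)
    have "(real (card S) ^ (Suc D * length u) * \<eta>) ^ q \<le> (1 / 4) ^ q"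
      using \<eta>' \<eta> by (intro power_mono) auto
    then have upper: "?a \<le> (1 / 4) ^ q"
      using sum_avoiding_le[OF q] by simp
    have "K * (image_weight (u_power ?m) * image_weight v * image_weight (u_power ?m)) \<le>
        2 * C\<^sup>2 * ?a * image_weight v * image_weight (u_power ?m)"
    proof -
      have "image_weight (u_power ?m @ v @ u_power ?m) \<le>
          2 * C\<^sup>2 * ?a * image_weight v * image_weight (u_power ?m)"
        by (rule image_weight_sandwich_le) (fact C m v avoid)+
      then show ?thesis
        using K(2)[OF m] by linarith
    qed
    then have "(K * image_weight (u_power ?m)) * (image_weight v * image_weight (u_power ?m)) \<le>
        (2 * C\<^sup>2 * ?a) * (image_weight v * image_weight (u_power ?m))"
      by (simp only: mult_ac)
    then have "K * image_weight (u_power ?m) \<le> 2 * C\<^sup>2 * ?a"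
      using mult_pos_pos[OF pos pos'] by (simp only: mult_le_cancel_right_pos)
    also have "\<dots> \<le> 2 * C\<^sup>2 * (1 / 4) ^ q"
      using upper by (intro mult_left_mono) auto
    finally have "K * (p b * (1 / 2) ^ q) \<le> 2 * C\<^sup>2 * (1 / 4) ^ q"
      using mult_left_mono[OF lower less_imp_le[OF K(1)]] by linarith
    also have "(1 / 4 :: real) ^ q = (1 / 2) ^ q * (1 / 2) ^ q"
      by (simp flip: power_mult_distrib)
    finally have "(K * p b) * (1 / 2) ^ q \<le> (2 * C\<^sup>2 * (1 / 2) ^ q) * (1 / 2) ^ q"
      by (simp only: mult_ac)
    then show ?thesis
      by (simp only: mult_le_cancel_right_pos zero_less_power half_gt_zero_iff zero_less_one)
  qed
  \<comment> \<open>The summand \<open>1\<close> keeps the divisor positive. Below,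
    \<open>Suc q\<close> replaces \<open>q\<close> because the bound asks for a positive
    exponent.\<close>
  have "0 < K * p b / (2 * C\<^sup>2 + 1)"
    using K(1) p_pos[OF b] by (intro divide_pos_pos mult_pos_pos) (auto intro: add_nonneg_pos)
  then obtain q where q: "(1 / 2 :: real) ^ q < K * p b / (2 * C\<^sup>2 + 1)"
    using real_arch_pow_inv[of _ "1 / 2 :: real"] by auto
  have pos': "0 < 2 * C\<^sup>2 + 1"
    by (simp add: add_nonneg_pos)
  have "(1 / 2 :: real) ^ Suc q * (2 * C\<^sup>2 + 1) \<le> (1 / 2) ^ q * (2 * C\<^sup>2 + 1)"
    using pos' by (intro mult_right_mono) auto
  also have "\<dots> < K * p b"
    using q by (simp only: pos_less_divide_eq[OF pos'])
  finally have "(1 / 2 :: real) ^ Suc q * (2 * C\<^sup>2 + 1) < K * p b" .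
  moreover have "2 * C\<^sup>2 * (1 / 2) ^ Suc q \<le> (1 / 2 :: real) ^ Suc q * (2 * C\<^sup>2 + 1)"
    by (simp add: algebra_simps)
  ultimately show False
    using bound[of "Suc q"] by linarith
qed

end

section \<open>Quasi-Bernoulli property, periodic words and heavy loops\<close>

lemma funpow_shift_map: "(shift_map ^^ j) y = (\<lambda>i. y (i + int j))"
  by (induction j) (auto simp: shift_map_def algebra_simps)

lemma lang_at_0:
  assumes transl: "\<And>y c. y \<in> Y \<Longrightarrow> (\<lambda>j. y (j + c)) \<in> Y" and w: "w \<in> lang Y"
  obtains y where "y \<in> Y" "subword y 0 (length w) = w"
proof -
  obtain y i where y: "y \<in> Y" "subword y i (length w) = w"
    using w by (auto simp: lang_def)
  have "subword (\<lambda>j. y (j + i)) 0 (length w) = w"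
    using y(2) by (simp add: subword_def add.commute)
  with transl[OF y(1)] that show thesis
    by blast
qed

text \<open>Birkhoff sums are additive along an orbit, so the exponential terms multiply exactly and
  only the Gibbs constants are lost; this gives \<open>K1 / K2^2\<close>.\<close>

lemma gibbs_measure_quasi_Bernoulli:
  assumes gibbs: "gibbs_measure Y \<nu>" and transl: "\<And>y c. y \<in> Y \<Longrightarrow> (\<lambda>j. y (j + c)) \<in> Y"
  obtains K where "K > 0"
    "\<And>v w. v \<noteq> [] \<Longrightarrow> w \<noteq> [] \<Longrightarrow> v @ w \<in> lang Y \<Longrightarrow>
      K * (measure \<nu> (cylinder Y v 0) * measure \<nu> (cylinder Y w 0)) \<le> measure \<nu> (cylinder Y (v @ w) 0)"
    "\<And>w. w \<noteq> [] \<Longrightarrow> w \<in> lang Y \<Longrightarrow> measure \<nu> (cylinder Y w 0) > 0"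
proof -
  obtain f K1 K2 Q where K: "K1 > 0" "K2 > 0"
    and bd: "\<And>z n. z \<in> Y \<Longrightarrow> n \<ge> 1 \<Longrightarrow>
      K1 < measure \<nu> (cylinder Y (subword z 0 n) 0) / exp (- real n * Q + (\<Sum>j<n. f ((shift_map ^^ j) z))) \<and>
      measure \<nu> (cylinder Y (subword z 0 n) 0) / exp (- real n * Q + (\<Sum>j<n. f ((shift_map ^^ j) z))) < K2"
    using gibbs unfolding gibbs_measure_def gibbs_measure_for_def by blast
  define E where "E z n = exp (- real n * Q + (\<Sum>j<n. f ((shift_map ^^ j) z)))" for z n
  have lo: "K1 * E z n < measure \<nu> (cylinder Y (subword z 0 n) 0)"
    and up: "measure \<nu> (cylinder Y (subword z 0 n) 0) < K2 * E z n" if "z \<in> Y" "n \<ge> 1" for z n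
    using bd[OF that] by (auto simp: E_def pos_less_divide_eq pos_divide_less_eq)
  have E_pos: "E z n > 0" for z n
    by (simp add: E_def)
  have "(K1 / K2\<^sup>2) * (measure \<nu> (cylinder Y v 0) * measure \<nu> (cylinder Y w 0)) \<le> measure \<nu> (cylinder Y (v @ w) 0)"
    if ne: "v \<noteq> []" "w \<noteq> []" and vw: "v @ w \<in> lang Y" for v w
  proof -
    let ?m = "length v" and ?n = "length w"
    obtain y where y: "y \<in> Y" "subword y 0 (length (v @ w)) = v @ w"
      using lang_at_0[OF transl vw] .
    define y' where "y' = (shift_map ^^ ?m) y"
    have y': "y' \<in> Y"
      unfolding y'_def funpow_shift_map by (rule transl[OF y(1)])
    have sub: "subword y 0 ?m = v" "subword y (int ?m) ?n = w"
      using y(2) by (simp_all add: subword_append)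
    have sub': "subword y' 0 ?n = w"
      using sub(2) by (simp add: y'_def funpow_shift_map subword_def add.commute)
    have "(\<Sum>j<?m + n. f ((shift_map ^^ j) y)) =
        (\<Sum>j<?m. f ((shift_map ^^ j) y)) + (\<Sum>j<n. f ((shift_map ^^ j) y'))" for n
      unfolding y'_def by (induction n) (auto simp: funpow_shift_map add_ac)
    from this[of ?n] have E: "E y (?m + ?n) = E y ?m * E y' ?n"
      unfolding E_def exp_add[symmetric] by (simp add: algebra_simps)
    have mn: "?m \<ge> 1" "?n \<ge> 1"
      using ne by (simp_all add: Suc_leI)
    have "measure \<nu> (cylinder Y v 0) * measure \<nu> (cylinder Y w 0) \<le> (K2 * E y ?m) * (K2 * E y' ?n)"
      using up[OF y(1) mn(1)] up[OF y' mn(2)] K E_pos[of y ?m] unfolding sub(1) sub'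
      by (intro mult_mono) (auto simp: less_imp_le)
    then have "(K1 / K2\<^sup>2) * (measure \<nu> (cylinder Y v 0) * measure \<nu> (cylinder Y w 0)) \<le>
        (K1 / K2\<^sup>2) * ((K2 * E y ?m) * (K2 * E y' ?n))"
      using K by (intro mult_left_mono) auto
    also have "\<dots> = K1 * E y (?m + ?n)"
      using K by (simp add: E power2_eq_square)
    also have "\<dots> \<le> measure \<nu> (cylinder Y (v @ w) 0)"
      using lo[OF y(1), of "?m + ?n"] y(2) mn by simp
    finally show ?thesis .
  qed
  moreover have "measure \<nu> (cylinder Y w 0) > 0" if ne: "w \<noteq> []" and w: "w \<in> lang Y" for w
  proof -
    obtain y where y: "y \<in> Y" "subword y 0 (length w) = w"
      using lang_at_0[OF transl w] .
    have "0 < K1 * E y (length w)"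
      using K E_pos by simp
    then show ?thesis
      using lo[OF y(1), of "length w"] y(2) ne by (simp add: Suc_leI)
  qed
  moreover have "K1 / K2\<^sup>2 > 0"
    using K by simp
  ultimately show thesis
    using that by blast
qed

section \<open>Paths, words of the image, and periods\<close>

lemma edge_shift_relpow: "x \<in> edge_shift E \<Longrightarrow> (x i, x (i + int k)) \<in> E ^^ k"
proof (induction k)
  case (Suc k)
  then show ?case
    using edge_shift_step[of x E i k] by auto
qed simp

lemma lang_relpow:
  assumes X: "X = edge_shift E" and w: "w \<in> lang X" and ij: "i \<le> j" "j < length w"
  shows "(w ! i, w ! j) \<in> E ^^ (j - i)"
proof -
  obtain x c where x: "x \<in> X" "w = subword x c (length w)"
    using w by (auto simp: lang_def)
  have "w ! m = x (c + int m)" if "m < length w" for m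
    using that by (subst x(2)) simp
  moreover have "c + int j = (c + int i) + int (j - i)"
    using ij by simp
  ultimately show ?thesis
    using edge_shift_relpow[of x E "c + int i" "j - i"] x(1) X ij by simp
qed

lemma mixing_relpow:
  assumes X: "X = edge_shift E" and mix: "mixing X" and st: "[s] \<in> lang X" "[t] \<in> lang X"
  shows "\<exists>N. \<forall>n\<ge>N. (s, t) \<in> E ^^ n"
proof -
  obtain N where N: "\<And>n. n \<ge> N \<Longrightarrow> \<exists>v. length v = n \<and> [s] @ v @ [t] \<in> lang X"
    using mix st unfolding mixing_def by meson
  have "(s, t) \<in> E ^^ n" if n: "n \<ge> Suc N" for n
  proof -
    obtain v where v: "length v = n - 1" "[s] @ v @ [t] \<in> lang X"
    proof -
      have "N \<le> n - 1"
        using n by simp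
      then show ?thesis
        using N that by blast
    qed
    have "(([s] @ v @ [t]) ! 0, ([s] @ v @ [t]) ! n) \<in> E ^^ (n - 0)"
      using v n by (intro lang_relpow[OF X v(2)]) auto
    moreover have "([s] @ v @ [t]) ! n = t"
      using v n by (cases n) (auto simp: nth_append)
    ultimately show ?thesis
      by simp
  qed
  then show ?thesis
    by blast
qed

lemma label_rel_in_lang:
  assumes X: "one_step X" and Y: "Y = \<pi> ` X" and \<pi>: "\<And>x. x \<in> X \<Longrightarrow> \<pi> x = (\<lambda>i. \<phi> (x i))"
    and w: "w \<noteq> []" "label_rel (transitions X) \<phi> w \<noteq> {}"
  shows "w \<in> lang Y"
proof -
  let ?n = "length w"
  obtain s t where "(s, t) \<in> label_rel (transitions X) \<phi> w"
    using w(2) by auto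
  then obtain q where q: "\<And>i. i < ?n \<Longrightarrow> (q i, q (Suc i)) \<in> transitions X \<and> \<phi> (q i) = w ! i"
    unfolding label_rel_iff_path by blast
  have "map q [0..<Suc ?n] \<in> lang X"
    using w(1) q by (intro path_in_lang[OF X]) auto
  then obtain x c m where x: "x \<in> X" "map q [0..<Suc ?n] = subword x c m"
    by (auto simp: lang_def)
  have m: "m = Suc ?n"
    using arg_cong[OF x(2), of length] by simp
  have "x (c + int i) = q i" if "i < ?n" for i
    using arg_cong[OF x(2), of "\<lambda>l. l ! i"] that m by (simp del: upt_Suc)
  then have "subword (\<pi> x) c ?n = w"
    using q by (simp add: subword_eq_iff \<pi>[OF x(1)])
  then show ?thesis
    using x(1) unfolding Y lang_def by (intro CollectI exI[of _ "\<pi> x"] exI[of _ c] exI[of _ ?n]) simp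
qed

text \<open>Otherwise \<open>i\<close> is invertible modulo the prime length, so multiples of
  \<open>i\<close> lead from index \<open>0\<close> to index \<open>k\<close>, and the two letters
  would agree.\<close>

lemma prime_length_aperiodic:
  assumes n: "prime (length u)" and k: "k < length u" "u ! k \<noteq> u ! 0"
    and per: "\<And>j. j < length u \<Longrightarrow> u ! ((i + j) mod length u) = u ! j"
  shows "length u dvd i"
proof (rule ccontr)
  let ?n = "length u"
  assume "\<not> ?n dvd i"
  then have "coprime i ?n"
    using n prime_imp_coprime by (metis coprime_commute)
  moreover have "i \<noteq> 0"
    using \<open>\<not> ?n dvd i\<close> dvd_0_right by metis
  ultimately obtain x y where "i * x = ?n * y + 1"
    using bezout_nat[of i ?n] by auto
  then have "i * (x * k) = k + ?n * (y * k)"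
    by (metis add.commute add_mult_distrib mult.assoc mult_1)
  then have "(i * (x * k)) mod ?n = k"
    using k(1) by (simp only: mod_mult_self2 mod_less)
  moreover have "u ! ((i * l) mod ?n) = u ! 0" for l
  proof (induction l)
    case (Suc l)
    have "(i * l) mod ?n < ?n"
      using k(1) by (intro mod_less_divisor) linarith
    then have "u ! ((i + (i * l) mod ?n) mod ?n) = u ! ((i * l) mod ?n)"
      by (rule per)
    then show ?case
      using Suc by (simp add: mod_add_right_eq)
  qed simp
  ultimately show False
    using k(2) by metis
qed

text \<open>On the cycle \<open>c\<close> the map \<open>nx\<close> follows the cycle; elsewhere it decreases the distance to \<open>c 0\<close>.\<close>

lemma successor_map_exists:
  assumes fin: "finite S" and F: "F \<subseteq> S \<times> S"
    and c: "inj_on c {..<n}" "n > 0" "c n = c 0" "\<And>i. i < n \<Longrightarrow> (c i, c (Suc i)) \<in> F"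
    and reach: "\<And>s. s \<in> S \<Longrightarrow> (s, c 0) \<in> F\<^sup>*"
  obtains nx D where "\<And>s. s \<in> S \<Longrightarrow> (s, nx s) \<in> F" "\<And>i. i < n \<Longrightarrow> nx (c i) = c (Suc i)"
    "\<And>s. s \<in> S \<Longrightarrow> \<exists>i\<le>D. (nx ^^ i) s = c 0"
proof -
  define dist where "dist s = (LEAST k. (s, c 0) \<in> F ^^ k)" for s
  have dist: "(s, c 0) \<in> F ^^ dist s" if "s \<in> S" for s
  proof -
    have "\<exists>k. (s, c 0) \<in> F ^^ k"
      using reach[OF that] by (simp add: rtrancl_power)
    then show ?thesis
      unfolding dist_def by (rule LeastI_ex)
  qed
  have closer: "\<exists>t. (s, t) \<in> F \<and> dist t < dist s" if s: "s \<in> S" "s \<noteq> c 0" for s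
  proof -
    obtain k where k: "dist s = Suc k"
      using dist[OF s(1)] s(2) by (cases "dist s") auto
    then have "(s, c 0) \<in> F ^^ Suc k"
      using dist[OF s(1)] by simp
    then obtain t where t: "(s, t) \<in> F" "(t, c 0) \<in> F ^^ k"
      by (meson relpow_Suc_D2)
    have "dist t \<le> k"
      unfolding dist_def using t(2) by (rule Least_le)
    then show ?thesis
      using t(1) k by auto
  qed
  \<comment> \<open>Injectivity of \<open>c\<close> on one period makes the successor along the
    cycle well defined; the distance to \<open>c 0\<close> may grow there.\<close>
  define nx where "nx s = (if s \<in> c ` {..<n} then c (Suc (the_inv_into {..<n} c s))
      else (SOME t. (s, t) \<in> F \<and> dist t < dist s))" for s
  have nx_c: "nx (c i) = c (Suc i)" if "i < n" for i
    using that c(1) by (simp add: nx_def the_inv_into_f_f)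
  have nx_other: "(s, nx s) \<in> F \<and> dist (nx s) < dist s" if "s \<in> S" "s \<notin> c ` {..<n}" for s
  proof -
    have "s \<noteq> c 0"
      using that(2) c(2) by auto
    then show ?thesis
      using someI_ex[OF closer[OF that(1)]] that(2) by (simp add: nx_def)
  qed
  have nx_F: "(s, nx s) \<in> F" if "s \<in> S" for s
    using that nx_other[OF that] nx_c c(4) by (cases "s \<in> c ` {..<n}") auto
  have ex: "\<exists>i. (nx ^^ i) s = c 0" if "s \<in> S" for s
    using that
  proof (induction "dist s" arbitrary: s rule: less_induct)
    case less
    show ?case
    proof (cases "s \<in> c ` {..<n}")
      case True
      then obtain i where i: "i < n" "s = c i"
        by blast
      have "(nx ^^ k) (c i) = c (i + k)" if "i + k \<le> n" for k
        using that by (induction k) (auto simp: nx_c)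
      from this[of "n - i"] show ?thesis
        using i c(3) by (intro exI[of _ "n - i"]) simp
    next
      case False
      then have "(s, nx s) \<in> F" "dist (nx s) < dist s"
        using nx_other less.prems by auto
      then obtain i where "(nx ^^ i) (nx s) = c 0"
        using less.hyps F by blast
      then show ?thesis
        by (intro exI[of _ "Suc i"]) (simp add: funpow_Suc_right del: funpow.simps)
    qed
  qed
  define f where "f s = (LEAST i. (nx ^^ i) s = c 0)" for s
  have f: "(nx ^^ f s) s = c 0" if "s \<in> S" for s
    unfolding f_def using ex[OF that] by (rule LeastI_ex)
  have "f s \<le> Max (f ` S)" if "s \<in> S" for s
    using that fin by (intro Max_ge) auto
  then have "\<exists>i\<le>Max (f ` S). (nx ^^ i) s = c 0" if "s \<in> S" for s
    using f that by blast
  with nx_F nx_c that show thesis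
    by blast
qed

text \<open>Every edge keeps positive probability, for the sake of full support; all edges but the
  preferred one get the same small value \<eta>, and the preferred one gets the rest.\<close>

lemma drifting_matrix_exists:
  fixes S :: "'s set"
  assumes fin: "finite S" and ne: "S \<noteq> {}" and F: "F \<subseteq> S \<times> S"
    and nx: "\<And>s. s \<in> S \<Longrightarrow> (s, nx s) \<in> F"
    and irr: "\<And>s t. s \<in> S \<Longrightarrow> t \<in> S \<Longrightarrow> (s, t) \<in> F\<^sup>*" and L: "L > 0"
  obtains P p \<eta> \<kappa> where "markov_chain S P p" "{(s, t). 0 < P s t} = F"
    "\<And>s t. t \<noteq> nx s \<Longrightarrow> P s t \<le> \<eta>" "\<And>s. s \<in> S \<Longrightarrow> \<kappa> \<le> P s (nx s)"
    "(0::real) \<le> \<eta>" "(0::real) < \<kappa>" "real (card S) ^ L * \<eta> \<le> 1 / 4" "1 / 2 \<le> \<kappa> ^ L"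
proof -
  define M where "M = real (card S)"
  have M: "M \<ge> 1"
    using fin ne by (simp add: M_def Suc_le_eq card_gt_0_iff)
  \<comment> \<open>\<open>M ^ L\<close> compensates the number of words of length \<open>L\<close>.
    The factor \<open>4 * L\<close> gives \<open>\<eta> * M \<le> 1 / (4 * L)\<close>, which
    Bernoulli's inequality turns into \<open>\<kappa> ^ L \<ge> 3 / 4\<close>.\<close>
  define \<eta> where "\<eta> = 1 / (4 * real L * M ^ L)"
  define \<kappa> where "\<kappa> = 1 - \<eta> * M"
  have \<eta>: "\<eta> > 0"
    using M L by (simp add: \<eta>_def)
  have "M ^ L * \<eta> = 1 / (4 * real L)"
    using M by (simp add: \<eta>_def)
  moreover have "\<dots> \<le> 1 / 4"
    using L by (simp add: field_simps)
  ultimately have \<eta>L: "M ^ L * \<eta> \<le> 1 / 4" by simp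
  have "\<eta> * M ^ 1 \<le> \<eta> * M ^ L"
    using M L \<eta> by (intro mult_left_mono power_increasing) auto
  also have "\<dots> = 1 / (4 * real L)"
    using M by (simp add: \<eta>_def)
  finally have \<eta>M: "\<eta> * M \<le> 1 / (4 * real L)" by simp
  also have "1 / (4 * real L) \<le> 1 / 4"
    using L by (simp add: field_simps)
  finally have \<kappa>: "3 / 4 \<le> \<kappa>"
    by (simp add: \<kappa>_def)
  have "real L * (\<eta> * M) \<le> 1 / 4"
    using mult_left_mono[OF \<eta>M, of "real L"] L by simp
  then have "3 / 4 \<le> 1 + real L * (- (\<eta> * M))"
    by simp
  also have "\<dots> \<le> (1 + (- (\<eta> * M))) ^ L"
    using \<kappa> by (intro Bernoulli_inequality) (simp add: \<kappa>_def)
  finally have \<kappa>L: "1 / 2 \<le> \<kappa> ^ L"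
    by (simp add: \<kappa>_def)
  define P where "P s t = (if (s, t) \<notin> F then 0 else if t = nx s then 1 - \<eta> * (real (card (F `` {s})) - 1) else \<eta>)"
    for s t
  have FS: "F `` {s} \<subseteq> S" for s
    using F by blast
  have heavy: "\<kappa> \<le> P s (nx s)" if "s \<in> S" for s
  proof -
    have "real (card (F `` {s})) - 1 \<le> M"
      unfolding M_def using card_mono[OF fin FS[of s]] by linarith
    then have "\<eta> * (real (card (F `` {s})) - 1) \<le> \<eta> * M"
      using \<eta> by (intro mult_left_mono) auto
    then show ?thesis
      using nx[OF that] by (simp add: P_def \<kappa>_def)
  qed
  have P_pos: "0 < P s t \<longleftrightarrow> (s, t) \<in> F" for s t
    using heavy[of s] \<kappa> \<eta> F by (auto simp: P_def)
  have P_nonneg: "0 \<le> P s t" for s t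
    using P_pos[of s t] by (cases "(s, t) \<in> F") (auto simp: P_def)
  have row: "(\<Sum>t\<in>S. P s t) = 1" if "s \<in> S" for s
  proof -
    have finF: "finite (F `` {s})"
      using FS fin by (rule finite_subset)
    have "(\<Sum>t\<in>S. P s t) = (\<Sum>t\<in>F `` {s}. P s t)"
      using FS fin by (intro sum.mono_neutral_right) (auto simp: P_def)
    also have "\<dots> = P s (nx s) + (\<Sum>t\<in>F `` {s} - {nx s}. P s t)"
      using nx[OF that] finF by (intro sum.remove) auto
    also have "(\<Sum>t\<in>F `` {s} - {nx s}. P s t) = (\<Sum>t\<in>F `` {s} - {nx s}. \<eta>)"
      by (intro sum.cong) (auto simp: P_def)
    also have "\<dots> = \<eta> * (real (card (F `` {s})) - 1)"
    proof -
      have "nx s \<in> F `` {s}"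
        using nx[OF that] by simp
      then have "card (F `` {s} - {nx s}) = card (F `` {s}) - 1" "card (F `` {s}) > 0"
        using finF by (auto simp: card_gt_0_iff)
      then show ?thesis
        by (simp add: of_nat_diff Suc_leI)
    qed
    also have "P s (nx s) = 1 - \<eta> * (real (card (F `` {s})) - 1)"
      using nx[OF that] by (simp add: P_def)
    finally show ?thesis by simp
  qed
  obtain p where p: "\<And>s. s \<in> S \<Longrightarrow> 0 \<le> p s" "(\<Sum>s\<in>S. p s) = 1" "\<And>t. t \<in> S \<Longrightarrow> (\<Sum>s\<in>S. p s * P s t) = p t"
    using stationary_distribution_exists[OF fin ne, of P] P_nonneg row by blast
  have p_step: "0 < p t" if "0 < p s" "(s, t) \<in> F" for s t
  proof -
    have st: "s \<in> S" "t \<in> S"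
      using that F by auto
    have "0 < p s * P s t"
      using that P_pos by simp
    also have "\<dots> \<le> (\<Sum>s\<in>S. p s * P s t)"
      using st fin p(1) P_nonneg by (intro member_le_sum) auto
    finally show ?thesis
      using p(3)[OF st(2)] by simp
  qed
  \<comment> \<open>Some state has positive mass, and by irreducibility it spreads along the edges
    to all states.\<close>
  obtain s0 where s0: "s0 \<in> S" "0 < p s0"
    using p(1,2) by (metis less_eq_real_def sum.neutral zero_neq_one)
  have p_pos: "0 < p t" if "t \<in> S" for t
  proof -
    have "(s0, t) \<in> F\<^sup>*"
      using irr s0 that by blast
    then show ?thesis
      by induction (use s0 p_step in auto)
  qed
  have "markov_chain S P p"
  proof
    show "P s t = 0" if "s \<notin> S \<or> t \<notin> S" for s t
      using that F by (auto simp: P_def)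
  qed (use fin P_nonneg row p_pos p in auto)
  moreover have "{(s, t). 0 < P s t} = F"
    using P_pos by auto
  moreover have "P s t \<le> \<eta>" if "t \<noteq> nx s" for s t
    using that \<eta> by (simp add: P_def)
  ultimately show thesis
    using that[of P p \<eta> \<kappa>] heavy \<eta> \<eta>L \<kappa> \<kappa>L by (simp add: M_def)
qed

section \<open>Block presentations\<close>

lemma measure_push_forward:
  assumes "continuous_map (shift_topology Z) (shift_topology X) \<theta>" "sets \<mu> = sets (borel_shift Z)"
    "V \<in> sets (borel_shift X)"
  shows "measure (push_forward \<mu> X \<theta>) V = measure \<mu> (\<theta> -` V \<inter> Z)"
proof -
  have "\<theta> \<in> measurable \<mu> (borel_shift X)"
    using measurable_borel_shift[OF assms(1)] assms(2) measurable_cong_sets by blast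
  moreover have "space \<mu> = Z"
    using sets_eq_imp_space_eq[OF assms(2)] by simp
  ultimately show ?thesis
    unfolding push_forward_def using assms(3) by (simp add: measure_distr)
qed

lemma sets_push_forward: "sets (push_forward \<mu> X \<theta>) = sets (borel_shift X)"
  by (simp add: push_forward_def)

lemma fully_supported_push_forward:
  assumes "prob_space \<mu>" and sets: "sets \<mu> = sets (borel_shift Z)" and full: "fully_supported Z \<mu>"
    and Z: "Z \<subseteq> full_shift A"
    and \<theta>: "continuous_map (shift_topology Z) (shift_topology X) \<theta>" "\<theta> ` Z = X"
  shows "fully_supported X (push_forward \<mu> X \<theta>)"
  unfolding fully_supported_def
proof (intro allI impI)
  fix w i assume "cylinder X w i \<noteq> {}"
  interpret prob_space \<mu> by fact
  define U where "U = \<theta> -` cylinder X w i \<inter> Z"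
  have "U = {z \<in> topspace (shift_topology Z). \<theta> z \<in> cylinder X w i}"
    by (auto simp: U_def)
  then have U: "openin (shift_topology Z) U"
    using openin_continuous_map_preimage[OF \<theta>(1) openin_cylinder] by simp
  obtain z where z: "z \<in> U"
    using \<open>cylinder X w i \<noteq> {}\<close> \<theta>(2) by (force simp: U_def cylinder_def)
  obtain k where k: "\<And>y. y \<in> Z \<Longrightarrow> \<forall>j. \<bar>j\<bar> \<le> int k \<longrightarrow> y j = z j \<Longrightarrow> y \<in> U"
    using U z unfolding openin_shift_topology by blast
  have zZ: "z \<in> Z"
    using z by (simp add: U_def)
  let ?V = "cylinder Z (subword z (- int (Suc k)) (2 * Suc k + 1)) (- int (Suc k))"
  have V: "y \<in> ?V \<longleftrightarrow> y \<in> Z \<and> (\<forall>j. \<bar>j\<bar> \<le> int (Suc k) \<longrightarrow> y j = z j)" for y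
    by (rule centered_cylinder_of_point(2)[OF zZ Z]) simp
  have "z \<in> ?V"
    unfolding V using zZ by blast
  then have "0 < measure \<mu> ?V"
    using full unfolding fully_supported_def by blast
  also have "?V \<subseteq> U"
  proof
    fix y assume "y \<in> ?V"
    then show "y \<in> U"
      unfolding V by (intro k) auto
  qed
  then have "measure \<mu> ?V \<le> measure \<mu> U"
    using U by (intro finite_measure_mono) (auto simp: sets sets_borel_shift)
  also have "\<dots> = measure (push_forward \<mu> X \<theta>) (cylinder X w i)"
    unfolding U_def by (rule measure_push_forward[OF \<theta>(1) sets cylinder_in_sets, symmetric])
  finally show "0 < measure (push_forward \<mu> X \<theta>) (cylinder X w i)" .
qed

context drifting_chain
begin

text \<open>The preimage of a cylinder is the disjoint union of the cylinders of the lifts. A lift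
  that is no path has an empty cylinder and weight \<open>0\<close>.\<close>

lemma measure_image_cylinder:
  assumes \<theta>: "continuous_map (shift_topology (edge_shift edges)) (shift_topology X) \<theta>"
    and \<pi>: "continuous_map (shift_topology X) (shift_topology Y) \<pi>"
    and g: "\<And>z. z \<in> edge_shift edges \<Longrightarrow> \<pi> (\<theta> z) = (\<lambda>i. g (z i))" and w: "w \<noteq> []"
  shows "measure (push_forward (push_forward law X \<theta>) Y \<pi>) (cylinder Y w 0) = image_weight w"
proof -
  let ?Z = "edge_shift edges"
  interpret prob_space law
    by (rule prob_space_law)
  have \<theta>X: "\<theta> z \<in> X" and \<pi>Y: "\<pi> (\<theta> z) \<in> Y" if "z \<in> ?Z" for z
    using \<theta> \<pi> that by (auto simp: continuous_map_def)
  have pre: "\<pi> -` cylinder Y w 0 \<inter> X \<in> sets (borel_shift X)"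
    using measurable_sets[OF measurable_borel_shift[OF \<pi>] cylinder_in_sets] by simp
  have "measure (push_forward (push_forward law X \<theta>) Y \<pi>) (cylinder Y w 0) =
      measure law (\<theta> -` (\<pi> -` cylinder Y w 0 \<inter> X) \<inter> ?Z)"
    by (simp only: measure_push_forward[OF \<pi> sets_push_forward cylinder_in_sets]
        measure_push_forward[OF \<theta> sets_law pre])
  also have "\<theta> -` (\<pi> -` cylinder Y w 0 \<inter> X) \<inter> ?Z = (\<Union>s\<in>lifts w. cylinder ?Z s 0)"
  proof (intro equalityI subsetI)
    fix z assume z: "z \<in> \<theta> -` (\<pi> -` cylinder Y w 0 \<inter> X) \<inter> ?Z"
    define s where "s = subword z 0 (length w)"
    have "map g s = w"
      using z g[of z] by (auto simp: s_def cylinder_def subword_eq_iff intro!: nth_equalityI)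
    moreover have "set s \<subseteq> S"
      using z edge_shift_full by (auto simp: s_def subword_def full_shift_def)
    ultimately have "s \<in> lifts w" "z \<in> cylinder ?Z s 0"
      using z by (auto simp: lifts_def cylinder_def s_def)
    then show "z \<in> (\<Union>s\<in>lifts w. cylinder ?Z s 0)"
      by blast
  next
    fix z assume "z \<in> (\<Union>s\<in>lifts w. cylinder ?Z s 0)"
    then obtain s where s: "map g s = w" "z \<in> ?Z" "subword z 0 (length s) = s"
      by (auto simp: lifts_def cylinder_def)
    have "subword (\<lambda>i. g (z i)) 0 (length w) = w"
      using s(3) s(1)[symmetric] by (auto simp: subword_eq_iff intro!: nth_equalityI)
    then show "z \<in> \<theta> -` (\<pi> -` cylinder Y w 0 \<inter> X) \<inter> ?Z"
      using s(2) g[OF s(2)] \<theta>X[OF s(2)] \<pi>Y[OF s(2)] by (auto simp: cylinder_def)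
  qed
  also have "measure law \<dots> = (\<Sum>s\<in>lifts w. measure law (cylinder ?Z s 0))"
  proof (rule finite_measure_finite_Union[OF finite_lifts])
    show "(\<lambda>s. cylinder ?Z s 0) ` lifts w \<subseteq> sets law"
      by (auto simp: sets_law cylinder_in_sets)
    show "disjoint_family_on (\<lambda>s. cylinder ?Z s 0) (lifts w)"
      by (auto simp: disjoint_family_on_def cylinder_def dest: length_lifts) (metis length_lifts)
  qed
  also have "\<dots> = image_weight w"
    unfolding image_weight_def using w
    by (intro sum.cong refl measure_law_cylinder) (auto simp: lifts_def)
  finally show ?thesis .
qed

end

text \<open>The higher block presentation: the new symbols are the words of length \<open>n\<close>,
  numbered because \<open>markov_measure\<close> represents alphabets by natural numbers.\<close>

locale block_presentation =
  fixes X :: "'a point set" and n N :: nat and dec :: "nat \<Rightarrow> 'a list"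
  assumes X_edge_shift: "X = edge_shift (transitions X)" and n: "2 \<le> n"
    and dec: "bij_betw dec {..<N} {w \<in> lang X. length w = n}"
begin

text \<open>Overlap alone suffices: since \<open>2 \<le> n\<close>, each transition of a decoded
  point already occurs inside a block, and \<open>X\<close> is determined by its
  transitions.\<close>

definition block_edges :: "(nat \<times> nat) set" where
  "block_edges = {(i, j). i < N \<and> j < N \<and> tl (dec i) = butlast (dec j)}"

definition decode :: "nat point \<Rightarrow> 'a point" where
  "decode z = (\<lambda>i. hd (dec (z i)))"

definition encode :: "'a point \<Rightarrow> nat point" where
  "encode x = (\<lambda>i. inv_into {..<N} dec (subword x i n))"

lemma dec_block: "s < N \<Longrightarrow> dec s \<in> lang X" "s < N \<Longrightarrow> length (dec s) = n"
  using dec by (auto simp: bij_betw_def)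

lemma block_edges_subset: "block_edges \<subseteq> {..<N} \<times> {..<N}"
  by (auto simp: block_edges_def)

lemma dec_Suc:
  assumes "(s, t) \<in> block_edges" "Suc k < n"
  shows "dec s ! Suc k = dec t ! k"
proof -
  have "length (dec s) = n" "length (dec t) = n" "tl (dec s) = butlast (dec t)"
    using assms(1) dec_block by (auto simp: block_edges_def)
  then show ?thesis
    using assms(2) by (metis Suc_lessE diff_Suc_1 length_tl less_diff_conv nth_butlast nth_tl Suc_eq_plus1 add.commute)
qed

lemma hd_dec: "s < N \<Longrightarrow> hd (dec s) = dec s ! 0"
  using dec_block(2)[of s] n by (cases "dec s") auto

lemma block_edge_transition:
  assumes "(s, t) \<in> block_edges"
  shows "(hd (dec s), hd (dec t)) \<in> transitions X"
proof -
  have st: "s < N" "t < N"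
    using assms by (auto simp: block_edges_def)
  have "(dec s ! 0, dec s ! 1) \<in> transitions X ^^ (1 - 0)"
    using dec_block[OF st(1)] n by (intro lang_relpow[OF X_edge_shift]) auto
  then show ?thesis
    using dec_Suc[OF assms, of 0] n by (simp add: hd_dec st)
qed

lemma decode_in: "z \<in> edge_shift block_edges \<Longrightarrow> decode z \<in> X"
  by (subst X_edge_shift) (auto simp: edge_shift_def decode_def intro: block_edge_transition)

lemma subword_decode:
  assumes z: "z \<in> edge_shift block_edges"
  shows "subword (decode z) i n = dec (z i)"
proof -
  have zN: "z i < N" for i
    using z by (auto simp: edge_shift_def block_edges_def)
  have "dec (z i) ! k = decode z (i + int k)" if "k < n" for k
    using that
  proof (induction k arbitrary: i)
    case 0
    then show ?case
      by (simp add: decode_def hd_dec zN)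
  next
    case (Suc k)
    have "dec (z i) ! Suc k = dec (z (i + 1)) ! k"
      using z Suc.prems by (intro dec_Suc) (auto simp: edge_shift_def)
    then show ?case
      using Suc.IH[of "i + 1"] Suc.prems by (simp add: add.assoc)
  qed
  then show ?thesis
    using dec_block(2)[OF zN] by (auto intro: nth_equalityI)
qed

lemma dec_encode:
  assumes "x \<in> X"
  shows "encode x i < N" "dec (encode x i) = subword x i n"
proof -
  have "subword x i n \<in> dec ` {..<N}"
  proof -
    have "subword x i n \<in> {w \<in> lang X. length w = n}"
      using assms by (auto simp: lang_def)
    then show ?thesis
      using dec by (simp add: bij_betw_def)
  qed
  then show "encode x i < N" "dec (encode x i) = subword x i n"
    using inv_into_into[of "subword x i n" dec "{..<N}"] f_inv_into_f[of "subword x i n" dec "{..<N}"]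
    by (simp_all add: encode_def)
qed

lemma encode_in: "x \<in> X \<Longrightarrow> encode x \<in> edge_shift block_edges"
  by (auto simp: edge_shift_def block_edges_def dec_encode intro!: nth_equalityI simp: nth_tl nth_butlast add.assoc)

lemma decode_encode: "x \<in> X \<Longrightarrow> decode (encode x) = x"
proof
  fix i assume "x \<in> X"
  then have "decode (encode x) i = dec (encode x i) ! 0"
    by (simp only: decode_def hd_dec[OF dec_encode(1)])
  then show "decode (encode x) i = x i"
    using n dec_encode(2)[OF \<open>x \<in> X\<close>] by simp
qed

lemma encode_decode: "z \<in> edge_shift block_edges \<Longrightarrow> encode (decode z) = z"
  using dec by (auto simp: encode_def subword_decode edge_shift_def block_edges_def bij_betw_def
      intro!: ext inv_into_f_f)

lemma conjugacy_decode: "conjugacy (edge_shift block_edges) X decode"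
proof -
  have "continuous_map (shift_topology (edge_shift block_edges)) (shift_topology X) decode"
  proof (rule continuous_map_shift_topology)
    fix i :: int
    show "\<exists>r. \<forall>x\<in>edge_shift block_edges. \<forall>z\<in>edge_shift block_edges.
        (\<forall>j. \<bar>j\<bar> \<le> int r \<longrightarrow> z j = x j) \<longrightarrow> decode z i = decode x i"
      by (intro exI[of _ "nat \<bar>i\<bar>"]) (auto simp: decode_def)
  qed (rule decode_in)
  moreover have "continuous_map (shift_topology X) (shift_topology (edge_shift block_edges)) encode"
  proof (rule continuous_map_shift_topology)
    fix i :: int
    have "encode z i = encode x i" if "\<forall>j. \<bar>j\<bar> \<le> int (nat \<bar>i\<bar> + n) \<longrightarrow> z j = x j" for x z
    proof -
      have "subword z i n = subword x i n"
        using that by (intro nth_equalityI) auto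
      then show ?thesis
        by (simp add: encode_def)
    qed
    then show "\<exists>r. \<forall>x\<in>X. \<forall>z\<in>X. (\<forall>j. \<bar>j\<bar> \<le> int r \<longrightarrow> z j = x j) \<longrightarrow> encode z i = encode x i"
      by blast
  qed (rule encode_in)
  ultimately have "homeomorphic_map (shift_topology (edge_shift block_edges)) (shift_topology X) decode"
    by (intro homeomorphic_maps_imp_map[of _ _ _ encode])
      (auto simp: homeomorphic_maps_def encode_decode decode_encode)
  then show ?thesis
    by (simp add: conjugacy_def decode_def shift_map_def)
qed

lemma block_edges_irreducible:
  assumes mix: "mixing X" and st: "s < N" "t < N"
  shows "(s, t) \<in> block_edges\<^sup>*"
proof -
  obtain v where "dec s @ v @ dec t \<in> lang X"
    using mix dec_block st unfolding mixing_def by blast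
  then obtain x i m where x: "x \<in> X" "dec s @ v @ dec t = subword x i m"
    by (auto simp: lang_def)
  have "m = n + (length v + n)"
    using arg_cong[OF x(2), of length] by (simp add: dec_block st)
  then have "dec s = subword x i n" "dec t = subword x (i + int (n + length v)) n"
    using x(2) by (simp_all add: subword_append dec_block st add.assoc)
  moreover have "inv_into {..<N} dec (dec s) = s" "inv_into {..<N} dec (dec t) = t"
    using dec st by (auto simp: bij_betw_def intro!: inv_into_f_f)
  ultimately have "encode x i = s" "encode x (i + int (n + length v)) = t"
    by (simp_all only: encode_def)
  then have "(s, t) \<in> block_edges ^^ (n + length v)"
    using edge_shift_relpow[OF encode_in[OF x(1)], of i "n + length v"] by simp
  then show ?thesis
    by (rule relpow_imp_rtrancl)
qed

end

section \<open>A Markov measure with non-Gibbs image\<close>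

theorem corollary5p7:
  fixes A :: "'a set"
    and X Y :: "'a point set"
    and \<pi> :: "'a point \<Rightarrow> 'a point"
  assumes "shift_of_finite_type A X"
    and "one_step X"
    and "mixing X"
    and "X \<noteq> {}"
    and "sofic_shift A Y"
    and "factor_map X Y \<pi>"
    and "one_block_map X \<pi>"
    and "class_degree X Y \<pi> > 1"
  shows "\<exists>\<mu>. markov_measure X \<mu> \<and> fully_supported X \<mu> \<and>
           \<not> gibbs_measure Y (push_forward \<mu> Y \<pi>)"
proof -
  define E where "E = transitions X"
  have X: "X = edge_shift E"
    unfolding E_def by (rule one_step_eq_edge_shift[OF assms(1,2)])
  have Y: "Y = \<pi> ` X" and \<pi>_cont: "continuous_map (shift_topology X) (shift_topology Y) \<pi>"
    using assms(6) by (auto simp: factor_map_def)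
  obtain \<phi> where \<pi>: "\<And>x. x \<in> X \<Longrightarrow> \<pi> x = (\<lambda>i. \<phi> (x i))"
    using assms(7) by (auto simp: one_block_map_def)
  have lang_A: "set w \<subseteq> A" if "w \<in> lang X" for w
    using that assms(1) by (fastforce simp: shift_of_finite_type_def lang_def subword_def full_shift_def)
  have finA: "finite A"
    using assms(1) by (simp add: shift_of_finite_type_def)
  have "E \<subseteq> A \<times> A"
    using lang_A by (fastforce simp: E_def transitions_def)
  then have finE: "finite E"
    using finA by (meson finite_SigmaI finite_subset)
  have letter: "[s] \<in> lang X" if "s \<in> Field E" for s
    using that lang_appendD[of "[_]" "[_]" X] by (auto simp: E_def transitions_def Field_def)
  have mix: "\<exists>N. \<forall>n\<ge>N. (s, t) \<in> E ^^ n" if "s \<in> Field E" "t \<in> Field E" for s t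
    using mixing_relpow[OF X assms(3)] letter that by blast
  have irr: "(s, t) \<in> E\<^sup>*" if "s \<in> Field E" "t \<in> Field E" for s t
    using mix[OF that] relpow_imp_rtrancl by blast
  obtain x0 where "x0 \<in> X"
    using assms(4) by blast
  define a where "a = x0 0"
  have a: "a \<in> Field E"
    using point_transitions[OF \<open>x0 \<in> X\<close>, of 0] by (auto simp: E_def a_def Field_def)
  have transl: "(\<lambda>j. y (j + c)) \<in> Y" if y: "y \<in> Y" for y c
  proof -
    obtain x where x: "x \<in> X" "y = \<pi> x"
      using y Y by blast
    then have x': "(\<lambda>j. x (j + c)) \<in> X"
      using edge_shift_translate X by blast
    have "(\<lambda>j. y (j + c)) = \<pi> (\<lambda>j. x (j + c))"
      using \<pi>[OF x(1)] \<pi>[OF x'] x(2) by simp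
    then show ?thesis
      using x' Y by blast
  qed
  \<comment> \<open>With a single label, label relations are powers of \<open>E\<close>; mixing
    joins all pairs of symbols in one common number of steps, and the class degree would be
    \<open>1\<close>.\<close>
  have "\<exists>a'\<in>Field E. \<phi> a' \<noteq> \<phi> a"
  proof (rule ccontr)
    assume "\<not> ?thesis"
    then have const: "\<phi> s = \<phi> a" if "s \<in> Field E" for s
      using that by blast
    have rel: "label_rel E \<phi> (replicate k (\<phi> a)) = E ^^ k" for k
    proof (induction k)
      case (Suc k)
      have "{(s, t) \<in> E. \<phi> s = \<phi> a} = E"
        using const by (auto simp: Field_def)
      then show ?case
        using Suc by (simp add: relpow_commute)
    qed simp
    define N where "N s t = (SOME N. \<forall>n\<ge>N. (s, t) \<in> E ^^ n)" for s t
    have N: "(s, t) \<in> E ^^ n" if "s \<in> Field E" "t \<in> Field E" "n \<ge> N s t" for s t n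
      using someI_ex[OF mix[OF that(1,2)]] that(3) by (simp add: N_def)
    \<comment> \<open>A time at which all pairs of symbols are joined; \<open>Suc\<close> keeps the
      word \<open>w\<close> nonempty.\<close>
    define M where "M = Suc (Max ((\<lambda>(s, t). N s t) ` (Field E \<times> Field E)))"
    have "N s t \<le> M" if "s \<in> Field E" "t \<in> Field E" for s t
      unfolding M_def using that finite_Field[OF finE] by (intro le_SucI Max_ge) auto
    then have M: "(s, t) \<in> E ^^ M" if "s \<in> Field E" "t \<in> Field E" for s t
      using N that by blast
    define w where "w = replicate M (\<phi> a)"
    have w: "w \<noteq> []"
      by (simp add: w_def M_def)
    have "class_degree X Y \<pi> \<le> 1"
    proof (rule class_degree_le_1[OF X Y \<pi>, of a w w])
      fix s t assume "(s, t) \<in> label_rel E \<phi> (w @ w)"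
      then have "s \<in> Field E" "t \<in> Field E"
        using label_rel_subset[of "w @ w" E \<phi>] w by auto
      then show "(s, a) \<in> label_rel E \<phi> w \<and> (a, t) \<in> label_rel E \<phi> w"
        using M a by (simp add: w_def rel)
    qed (use M a w in \<open>auto simp: w_def rel\<close>)
    then show False
      using assms(8) by simp
  qed
  then obtain a' where a': "a' \<in> Field E" "\<phi> a' \<noteq> \<phi> a"
    by blast
  obtain k where k: "(a, a') \<in> E ^^ k"
    using mix[OF a a'(1)] by blast
  obtain M where M: "\<And>n. n \<ge> M \<Longrightarrow> (a', a) \<in> E ^^ n"
    using mix[OF a'(1) a] by blast
  \<comment> \<open>After the \<open>k\<close> steps to \<open>a'\<close> at least \<open>M\<close>
    steps remain for the return, so a loop of length exactly \<open>n\<close> exists.\<close>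
  obtain n where n: "prime n" "k + M < n"
    using bigger_prime by blast
  have "(a', a) \<in> E ^^ (n - k)"
    using n by (intro M) simp
  obtain q where q: "q 0 = a" "q n = a" "q k = a'" "\<And>i. i < n \<Longrightarrow> (q i, q (Suc i)) \<in> E"
  proof -
    obtain q1 where q1: "q1 0 = a" "q1 k = a'" "\<And>i. i < k \<Longrightarrow> (q1 i, q1 (Suc i)) \<in> E"
      using k by (auto simp: relpow_fun_conv)
    obtain q2 where q2: "q2 0 = a'" "q2 (n - k) = a" "\<And>i. i < n - k \<Longrightarrow> (q2 i, q2 (Suc i)) \<in> E"
      using \<open>(a', a) \<in> E ^^ (n - k)\<close> by (auto simp: relpow_fun_conv)
    define q where "q i = (if i \<le> k then q1 i else q2 (i - k))" for i
    have "(q i, q (Suc i)) \<in> E" if "i < n" for i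
      using q1 q2(1) q2(3)[of "i - k"] that
      by (cases "i < k"; cases "i = k") (auto simp: q_def Suc_diff_le)
    then show thesis
      using that[of q] q1 q2 n by (auto simp: q_def)
  qed
  have n2: "2 \<le> n"
    using n(1) by (rule prime_ge_2_nat)
  define u where "u = map (\<lambda>i. \<phi> (q i)) [0..<n]"
  have len_u [simp]: "length u = n"
    by (simp add: u_def)
  have u_ne: "u \<noteq> []"
    using n2 len_u by force
  have u_loop: "(a, a) \<in> label_rel E \<phi> u"
    unfolding u_def using path_label_rel[of n q E \<phi>] q by simp
  have "u ! k \<noteq> u ! 0"
    using n a' q by (simp add: u_def)
  then have aperiodic: "length u dvd i" if "\<And>j. j < length u \<Longrightarrow> u ! ((i + j) mod length u) = u ! j" for i
    using prime_length_aperiodic[of u k i] n that by simp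
  obtain v where v_ne: "\<And>m. label_rel E \<phi> (concat (replicate m u) @ v @ concat (replicate m u)) \<noteq> {}"
    and v_not: "\<And>i j. (a, a) \<notin> label_rel E \<phi> (concat (replicate i u) @ v @ concat (replicate j u))"
    using class_degree_gt_1_obstruction[OF X Y \<pi> assms(8) finE irr u_loop u_ne] by blast
  have v: "v \<noteq> []"
    using v_not[of 0 0] by auto
  \<comment> \<open>Blocks as long as the loop: each block along it shows a full period.\<close>
  define B where "B = {w \<in> lang X. length w = n}"
  have "B \<subseteq> {w. set w \<subseteq> A \<and> length w = n}"
    using lang_A by (auto simp: B_def)
  then have "finite B"
    using finite_lists_length_eq[OF finA] finite_subset by blast
  then obtain dec where dec: "bij_betw dec {..<card B} B"
    using ex_bij_betw_nat_finite[of B] by (auto simp: atLeast0LessThan)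
  interpret block_presentation X n "card B" dec
    using X n2 dec by unfold_locales (auto simp: E_def B_def)
  let ?S = "{..<card B}" and ?F = block_edges
  \<comment> \<open>The periodic point that runs through the loop; its block code \<open>c\<close>
    is the cycle that the chain will prefer.\<close>
  define x where "x = (\<lambda>i. q (nat (i mod int n)))"
  have x: "x \<in> X"
    unfolding X x_def using n2 q by (intro periodic_point) auto
  have x_nat: "x (int i) = q (i mod n)" for i
    by (simp add: x_def flip: zmod_int)
  define c where "c i = encode x (int i)" for i
  have c_S: "c i \<in> ?S" for i
    using dec_encode(1)[OF x] by (simp add: c_def)
  have dec_c: "dec (c i) ! j = q ((i + j) mod n)" if "j < n" for i j
    using that dec_encode(2)[OF x, of "int i"] x_nat[of "i + j"] by (simp add: c_def)
  have c_F: "(c i, c (Suc i)) \<in> ?F" for i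
    using edge_shift_step[OF encode_in[OF x], of 0 i] by (simp add: c_def)
  have "subword x (int n) n = subword x 0 n"
    by (intro nth_equalityI) (auto simp: x_def)
  then have c_per: "c n = c 0"
    by (simp add: c_def encode_def)
  have lab: "\<phi> (q j) = u ! j" if "j < n" for j
    using that by (simp add: u_def)
  have no_rep: "False" if ij: "i < j" "j < n" "c i = c j" for i j
  proof -
    have "u ! ((j - i + m) mod length u) = u ! m" if m: "m < length u" for m
    proof -
      \<comment> \<open>The offset at which block \<open>i\<close> shows position \<open>m\<close>
        of the loop; block \<open>j\<close> shows position \<open>j - i + m\<close> there, taken
        modulo \<open>n\<close>.\<close>
      define l where "l = (m + n - i) mod n"
      have "l < n"
        using n2 by (simp add: l_def)
      have "(i + l) mod n = (i + (m + n - i)) mod n"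
        unfolding l_def by (rule mod_add_right_eq)
      also have "\<dots> = m"
        using ij m by simp
      finally have il: "(i + l) mod n = m" .
      have "(j + l) mod n = (j - i + (i + l)) mod n"
        using ij by simp
      also have "\<dots> = (j - i + m) mod n"
        by (metis il mod_add_right_eq)
      finally have jl: "(j + l) mod n = (j - i + m) mod n" .
      have "q ((i + l) mod n) = q ((j + l) mod n)"
        using dec_c[OF \<open>l < n\<close>, of i] dec_c[OF \<open>l < n\<close>, of j] ij(3) by simp
      then have "\<phi> (q m) = \<phi> (q ((j - i + m) mod n))"
        by (simp only: il jl)
      then show ?thesis
        using m n2 by (simp add: lab)
    qed
    then have "n dvd j - i"
      using aperiodic[of "j - i"] by simp
    then show False
      using ij by (auto dest!: dvd_imp_le)
  qed
  have c_inj: "inj_on c {..<n}"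
    using no_rep by (intro inj_onI) (metis lessThan_iff linorder_neqE_nat)
  have irrF: "(s, t) \<in> ?F\<^sup>*" if "s \<in> ?S" "t \<in> ?S" for s t
    using block_edges_irreducible[OF assms(3)] that by simp
  obtain nx D where nx: "\<And>s. s \<in> ?S \<Longrightarrow> (s, nx s) \<in> ?F" "\<And>i. i < n \<Longrightarrow> nx (c i) = c (Suc i)"
      "\<And>s. s \<in> ?S \<Longrightarrow> \<exists>i\<le>D. (nx ^^ i) s = c 0"
    using successor_map_exists[OF _ block_edges_subset c_inj _ c_per c_F irrF[OF _ c_S]] n2 by auto
  have S_ne: "?S \<noteq> {}"
    using c_S by blast
  \<comment> \<open>The length of a stretch in which an avoiding lift must take a light
    step.\<close>
  have L_pos: "0 < Suc D * length u"
    using n2 by simp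
  obtain P p \<eta> \<kappa> where chain: "markov_chain ?S P p" and edges_P: "{(s, t). 0 < P s t} = ?F"
    and light: "\<And>s t. t \<noteq> nx s \<Longrightarrow> P s t \<le> \<eta>" and heavy: "\<And>s. s \<in> ?S \<Longrightarrow> \<kappa> \<le> P s (nx s)"
    and \<eta>: "0 \<le> \<eta>" and \<kappa>: "0 < \<kappa>"
    and \<eta>': "real (card ?S) ^ (Suc D * length u) * \<eta> \<le> 1 / 4"
    and \<kappa>': "1 / 2 \<le> \<kappa> ^ (Suc D * length u)"
    by (rule drifting_matrix_exists[OF finite_lessThan S_ne block_edges_subset _ _ L_pos, of nx])
      (rule nx(1) irrF that; assumption)+
  define g where "g s = \<phi> (hd (dec s))" for s
  have nx_pow: "(nx ^^ i) (c 0) = c i" if "i \<le> n" for i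
    using that by (induction i) (auto simp: nx(2))
  interpret markov_chain ?S P p
    by (rule chain)
  interpret drifting_chain ?S P p g u "c 0" nx D \<eta> \<kappa>
  proof
    show "nx s \<in> ?S" if "s \<in> ?S" for s
      using nx(1)[OF that] block_edges_subset by blast
    show "(nx ^^ length u) (c 0) = c 0"
      using nx_pow[of n] c_per by simp
    show "g ((nx ^^ j) (c 0)) = u ! j" if "j < length u" for j
      using that n2 nx_pow[of j] c_S[of j] dec_c[of 0 j] by (simp add: g_def hd_dec lab)
    show "\<exists>i\<le>D. (nx ^^ i) s = c 0" if "s \<in> ?S" for s
      using that by (rule nx(3))
    show "length u dvd i" if "\<And>j. j < length u \<Longrightarrow> u ! ((i + j) mod length u) = u ! j" for i
      using that by (rule aperiodic)
    show "P s t \<le> \<eta>" if "t \<noteq> nx s" for s t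
      using that by (rule light)
    show "\<kappa> \<le> P s (nx s)" if "s \<in> ?S" for s
      using that by (rule heavy)
  qed (fact u_ne c_S \<eta> \<kappa>)+
  have edges_F: "edges = ?F"
    unfolding edges_def by (rule edges_P)
  define \<mu> where "\<mu> = push_forward law X decode"
  have conj: "conjugacy (edge_shift edges) X decode"
    using conjugacy_decode by (simp add: edges_F)
  then have hom: "homeomorphic_map (shift_topology (edge_shift edges)) (shift_topology X) decode"
    by (simp add: conjugacy_def)
  have decode_cont: "continuous_map (shift_topology (edge_shift edges)) (shift_topology X) decode"
    using hom homeomorphic_imp_continuous_map by blast
  have "markov_measure X \<mu>"
    unfolding markov_measure_def \<mu>_def using one_step_markov_law conj by blast
  moreover have "fully_supported X \<mu>"
    unfolding \<mu>_def
  proof (rule fully_supported_push_forward[OF prob_space_law sets_law fully_supported_law edge_shift_full decode_cont])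
    show "decode ` edge_shift edges = X"
      using homeomorphic_imp_surjective_map[OF hom] by simp
  qed
  moreover have "\<not> gibbs_measure Y (push_forward \<mu> Y \<pi>)"
  proof
    assume gibbs: "gibbs_measure Y (push_forward \<mu> Y \<pi>)"
    have image: "measure (push_forward \<mu> Y \<pi>) (cylinder Y w 0) = image_weight w" if "w \<noteq> []" for w
      unfolding \<mu>_def
    proof (rule measure_image_cylinder[OF decode_cont \<pi>_cont _ that])
      fix z assume "z \<in> edge_shift edges"
      then have "decode z \<in> X"
        using decode_in by (simp add: edges_F)
      then show "\<pi> (decode z) = (\<lambda>i. g (z i))"
        by (simp add: \<pi> g_def decode_def)
    qed
    obtain K where K: "K > 0"
      and qB: "\<And>v w. v \<noteq> [] \<Longrightarrow> w \<noteq> [] \<Longrightarrow> v @ w \<in> lang Y \<Longrightarrow>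
        K * (image_weight v * image_weight w) \<le> image_weight (v @ w)"
      and pos: "\<And>w. w \<noteq> [] \<Longrightarrow> w \<in> lang Y \<Longrightarrow> image_weight w > 0"
      using gibbs_measure_quasi_Bernoulli[OF gibbs transl] image by (metis append_is_Nil_conv)
    have word: "u_power m @ v @ u_power m \<in> lang Y" for m
      using label_rel_in_lang[OF assms(2) Y \<pi>, of "u_power m @ v @ u_power m"] v v_ne
      by (simp add: E_def)
    have vu: "v @ u_power m \<in> lang Y" for m
      using word by (rule lang_appendD)
    have "v \<in> lang Y"
      using vu by (rule lang_appendD)
    show False
    proof (rule not_quasi_Bernoulli[OF v pos[OF v \<open>v \<in> lang Y\<close>] \<eta>' \<kappa>'])
      \<comment> \<open>The quasi-Bernoulli inequality is used at both joints, hence the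
        square.\<close>
      show "0 < K\<^sup>2"
        using K by simp
      fix m :: nat assume "m > 0"
      then have ne: "u_power m \<noteq> []"
        using u_ne by (cases m) auto
      have "K\<^sup>2 * (image_weight (u_power m) * image_weight v * image_weight (u_power m)) =
          K * (image_weight (u_power m) * (K * (image_weight v * image_weight (u_power m))))"
        by (simp add: power2_eq_square)
      also have "\<dots> \<le> K * (image_weight (u_power m) * image_weight (v @ u_power m))"
        using K qB[OF v ne vu] image_weight_nonneg[OF ne] by (intro mult_left_mono) auto
      also have "\<dots> \<le> image_weight (u_power m @ v @ u_power m)"
        using v by (intro qB[OF ne _ word]) simp
      finally show "K\<^sup>2 * (image_weight (u_power m) * image_weight v * image_weight (u_power m)) \<le>
          image_weight (u_power m @ v @ u_power m)" .
    next
      fix m s t r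
      assume s: "s \<in> lifts (u_power m)" and t: "t \<in> lifts v" and r: "r \<in> lifts (u_power m)"
        and pos: "word_weight (s @ t @ r) > 0"
      show "s \<in> avoiding m \<or> r \<in> avoiding m"
      proof (rule ccontr)
        assume "\<not> ?thesis"
        \<comment> \<open>Both outer blocks are at \<open>c 0\<close>, whose first symbol is
          \<open>a\<close>, at the start of a copy of \<open>u\<close>. The part in between decodes
          to a lift from \<open>a\<close> to \<open>a\<close> of the kind that the choice of
          \<open>v\<close> forbids.\<close>
        then obtain i j where ij: "i < m" "s ! (i * n) = c 0" "j < m" "r ! (j * n) = c 0"
          using s r by (auto simp: avoiding_def)
        define \<omega> where "\<omega> = s @ t @ r"
        have len: "length s = m * n" "length t = length v" "length r = m * n"
          using length_lifts s t r by (fastforce simp: length_concat_replicate)+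
        have lt: "i * n < m * n" "j * n < m * n"
          using ij n2 by simp_all
        have \<omega>g: "map g \<omega> = u_power m @ v @ u_power m"
          using s t r by (auto simp: lifts_def \<omega>_def)
        have step: "(\<omega> ! l, \<omega> ! Suc l) \<in> ?F" if "Suc l < length \<omega>" for l
        proof (rule ccontr)
          assume "(\<omega> ! l, \<omega> ! Suc l) \<notin> ?F"
          then have "P (\<omega> ! l) (\<omega> ! Suc l) = 0"
            using P_nonneg[of "\<omega> ! l" "\<omega> ! Suc l"] unfolding edges_P[symmetric] by force
          then have "word_weight \<omega> = 0"
            using that by (auto simp: word_weight_def intro!: bexI[of _ l])
          then show False
            using pos by (simp add: \<omega>_def)
        qed
        define h where "h l = hd (dec (\<omega> ! (i * n + l)))" for l
        \<comment> \<open>The distance between the two visits: \<open>m - i\<close> copies of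
          \<open>u\<close>, then \<open>v\<close>, then \<open>j\<close> copies of
          \<open>u\<close>.\<close>
        define L where "L = (m - i) * n + length v + j * n"
        have mi: "i * n + (m - i) * n = m * n"
          using ij(1) by (simp flip: add_mult_distrib)
        have "length \<omega> = m * n + length v + m * n"
          by (simp add: \<omega>_def len)
        then have L: "i * n + L = m * n + length v + j * n" "i * n + L < length \<omega>"
          using mi lt unfolding L_def by linarith+
        have edge: "(h l, h (Suc l)) \<in> E" if "l < L" for l
          unfolding h_def E_def using block_edge_transition[OF step[of "i * n + l"]] L(2) that by simp
        have ha: "hd (dec (c 0)) = a"
          using c_S[of 0] dec_c[of 0 0] n2 q(1) by (simp add: hd_dec)
        have "\<omega> ! (i * n + 0) = c 0"
          using ij(2) lt(1) by (simp add: \<omega>_def nth_append len)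
        then have h0: "h 0 = a"
          unfolding h_def by (simp only: ha)
        have "\<omega> ! (i * n + L) = c 0"
          unfolding L(1) using ij(4) by (simp add: \<omega>_def nth_append len)
        then have hL: "h L = a"
          unfolding h_def by (simp only: ha)
        have "u_power m = u_power (i + (m - i))" "u_power m = u_power (j + (m - j))"
          using ij by simp_all
        then have "map g \<omega> = u_power i @ (u_power (m - i) @ v @ u_power j) @ u_power (m - j)"
          unfolding \<omega>g by (metis append.assoc concat_append replicate_add)
        moreover have "length (u_power i) = i * n" "length (u_power (m - i) @ v @ u_power j) = L"
          by (simp_all add: length_concat_replicate L_def)
        ultimately have "take L (drop (i * n) (map g \<omega>)) = u_power (m - i) @ v @ u_power j"
          by (simp add: append_eq_conv_conj)
        moreover have "take L (drop (i * n) (map g \<omega>)) = map (\<lambda>l. \<phi> (h l)) [0..<L]"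
          using L(2) by (intro nth_equalityI) (auto simp: h_def g_def)
        ultimately have "(a, a) \<in> label_rel E \<phi> (u_power (m - i) @ v @ u_power j)"
          using path_label_rel[of L h E \<phi>] edge h0 hL by simp
        then show False
          using v_not by blast
      qed
    qed
  qed
  ultimately show ?thesis
    by blast
qed

end
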